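(* Let $A$ and $B$ be uniform algebras and let $T: A\to B$ be a weak-local isometry. Then there exist a unimodular element $u\in B$ and a unital algebra homomorphism $\psi: A\to B$ such that $T(f)=u\,\psi(f)$ for all $f\in A$.
   Context: A uniform algebra is a norm closed subalgebra of $C(K)$ (complex-valued continuous functions with the supremum norm), for some compact Hausdorff space $K$, which contains the constant functions and separates the points of $K$. An element $u$ of a uniform algebra $B\subseteq C(Q)$ is unimodular if $|u(s)|=1$ for all $s\in Q$. For Banach spaces $X,Y$, $\mathrm{Iso}(X,Y)$ denotes the set of all surjective linear isometries from $X$ onto $Y$. A weak-local isometry $T:X\to Y$ is a linear mapping such that for each $x\in X$ and $\phi\in Y^*$ there exists $T_{x,\phi}\in \mathrm{Iso}(X,Y)$, depending on $x$ and $\phi$, with $\phi(T(x))=\phi(T_{x,\phi}(x))$. *)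

theory Defs
  imports "HOL-Analysis.Analysis"
begin

text \<open>
  For a compact Hausdorff space \<open>K\<close>, presented as a type \<open>'k :: t2_space\<close> with \<open>compact UNIV\<close>,
  the library type \<open>'k \<Rightarrow>\<^sub>C complex\<close> of bounded continuous functions with the supremum norm
  is \<open>C(K)\<close>. The library provides its normed space structure; here is the pointwise product.
\<close>

unbundle bcontfun.lifting

instantiation bcontfun :: (topological_space, real_normed_algebra_1) real_normed_algebra_1
begin

lift_definition times_bcontfun :: "('a \<Rightarrow>\<^sub>C 'b) \<Rightarrow> ('a \<Rightarrow>\<^sub>C 'b) \<Rightarrow> 'a \<Rightarrow>\<^sub>C 'b"
  is "\<lambda>f g x. f x * g x"
proof -
  fix f g :: "'a \<Rightarrow> 'b"
  assume f: "f \<in> bcontfun" and g: "g \<in> bcontfun"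
  obtain a where a: "\<And>x. norm (f x) \<le> a"
    using f by (auto simp: bcontfun_def bounded_iff)
  obtain b where b: "\<And>x. norm (g x) \<le> b"
    using g by (auto simp: bcontfun_def bounded_iff)
  have "norm (f x * g x) \<le> a * b" for x
    using norm_mult_ineq[of "f x" "g x"] mult_mono[OF a b, of x x] norm_ge_zero[of "f x"] a[of x]
    by (smt (verit) norm_ge_zero)
  then show "(\<lambda>x. f x * g x) \<in> bcontfun"
    using f g by (intro bcontfun_normI) (auto simp: bcontfun_def intro!: continuous_intros)
qed

lift_definition one_bcontfun :: "'a \<Rightarrow>\<^sub>C 'b" is "\<lambda>_. 1"
  by (rule const_bcontfun)

instance
proof
  fix f g h :: "'a \<Rightarrow>\<^sub>C 'b" and r :: real
  show "f * g * h = f * (g * h)" by transfer (simp add: mult.assoc)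
  show "(f + g) * h = f * h + g * h" by transfer (simp add: distrib_right)
  show "f * (g + h) = f * g + f * h" by transfer (simp add: distrib_left)
  show "(r *\<^sub>R f) * g = r *\<^sub>R (f * g)" by transfer simp
  show "f * (r *\<^sub>R g) = r *\<^sub>R (f * g)" by transfer simp
  show "1 * f = f" by transfer simp
  show "f * 1 = f" by transfer simp
  have one: "apply_bcontfun (1 :: 'a \<Rightarrow>\<^sub>C 'b) x = 1" for x
    by transfer simp
  show "(0 :: 'a \<Rightarrow>\<^sub>C 'b) \<noteq> 1"
    by (metis one zero_bcontfun.rep_eq zero_neq_one)
  show "norm (1 :: 'a \<Rightarrow>\<^sub>C 'b) = 1"
  proof (rule antisym)
    show "norm (1 :: 'a \<Rightarrow>\<^sub>C 'b) \<le> 1"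
      by (rule norm_bound) (simp add: one)
    show "1 \<le> norm (1 :: 'a \<Rightarrow>\<^sub>C 'b)"
      using norm_bounded[of "1 :: 'a \<Rightarrow>\<^sub>C 'b"] by (simp add: one)
  qed
  show "norm (f * g) \<le> norm f * norm g"
  proof (rule norm_bound)
    fix x
    have "norm (apply_bcontfun (f * g) x) \<le> norm (f x) * norm (g x)"
      by (simp add: times_bcontfun.rep_eq norm_mult_ineq)
    also have "\<dots> \<le> norm f * norm g"
      by (intro mult_mono norm_bounded) auto
    finally show "norm (apply_bcontfun (f * g) x) \<le> norm f * norm g" .
  qed
qed

end

lift_definition scaleC_bcontfun :: "complex \<Rightarrow> ('k::topological_space \<Rightarrow>\<^sub>C complex) \<Rightarrow> 'k \<Rightarrow>\<^sub>C complex"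
    (infixr \<open>*\<^sub>C\<close> 75)
  is "\<lambda>c f x. c * f x"
proof -
  fix c :: complex and f :: "'k \<Rightarrow> complex"
  assume "f \<in> bcontfun"
  then show "(\<lambda>x. c * f x) \<in> bcontfun"
    unfolding bcontfun_def
    by (auto intro!: continuous_intros bounded_linear_image[OF _ bounded_linear_mult_right, of "range f" c,
          unfolded image_image])
qed

definition uniform_algebra :: "('k::t2_space \<Rightarrow>\<^sub>C complex) set \<Rightarrow> bool" where
  "uniform_algebra A \<longleftrightarrow>
     compact (UNIV :: 'k set) \<and>
     closed A \<and>
     (\<forall>f\<in>A. \<forall>g\<in>A. f + g \<in> A) \<and>
     (\<forall>c. \<forall>f\<in>A. c *\<^sub>C f \<in> A) \<and>
     (\<forall>f\<in>A. \<forall>g\<in>A. f * g \<in> A) \<and>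
     (\<forall>c. const_bcontfun c \<in> A) \<and>
     (\<forall>s t. s \<noteq> t \<longrightarrow> (\<exists>f\<in>A. f s \<noteq> f t))"

definition unimodular :: "('k::topological_space \<Rightarrow>\<^sub>C complex) \<Rightarrow> bool" where
  "unimodular u \<longleftrightarrow> (\<forall>s. cmod (u s) = 1)"

text \<open>
  Maps defined on a uniform algebra \<open>A\<close> are total functions of which only the values on \<open>A\<close>
  are constrained.
\<close>

definition clinear_on ::
    "('k::topological_space \<Rightarrow>\<^sub>C complex) set \<Rightarrow> (('k \<Rightarrow>\<^sub>C complex) \<Rightarrow> ('q::topological_space \<Rightarrow>\<^sub>C complex)) \<Rightarrow> bool"
  where
  "clinear_on A T \<longleftrightarrow>
     (\<forall>f\<in>A. \<forall>g\<in>A. T (f + g) = T f + T g) \<and>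
     (\<forall>c. \<forall>f\<in>A. T (c *\<^sub>C f) = c *\<^sub>C T f)"

definition surj_lin_isometries ::
    "('k::topological_space \<Rightarrow>\<^sub>C complex) set \<Rightarrow> ('q::topological_space \<Rightarrow>\<^sub>C complex) set \<Rightarrow>
     (('k \<Rightarrow>\<^sub>C complex) \<Rightarrow> ('q \<Rightarrow>\<^sub>C complex)) set" where
  "surj_lin_isometries A B =
     {S. clinear_on A S \<and> S ` A = B \<and> (\<forall>f\<in>A. \<forall>g\<in>A. dist (S f) (S g) = dist f g)}"

definition dual :: "('q::topological_space \<Rightarrow>\<^sub>C complex) set \<Rightarrow> (('q \<Rightarrow>\<^sub>C complex) \<Rightarrow> complex) set" where
  "dual B =
     {\<phi>. (\<forall>f\<in>B. \<forall>g\<in>B. \<phi> (f + g) = \<phi> f + \<phi> g) \<and>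
         (\<forall>c. \<forall>f\<in>B. \<phi> (c *\<^sub>C f) = c * \<phi> f) \<and>
         (\<exists>M. \<forall>f\<in>B. cmod (\<phi> f) \<le> M * norm f)}"

definition weak_local_isometry ::
    "('k::topological_space \<Rightarrow>\<^sub>C complex) set \<Rightarrow> ('q::topological_space \<Rightarrow>\<^sub>C complex) set \<Rightarrow>
     (('k \<Rightarrow>\<^sub>C complex) \<Rightarrow> ('q \<Rightarrow>\<^sub>C complex)) \<Rightarrow> bool" where
  "weak_local_isometry A B T \<longleftrightarrow>
     clinear_on A T \<and> T ` A \<subseteq> B \<and>
     (\<forall>f\<in>A. \<forall>\<phi>\<in>dual B. \<exists>S\<in>surj_lin_isometries A B. \<phi> (T f) = \<phi> (S f))"

definition unital_algebra_hom ::
    "('k::topological_space \<Rightarrow>\<^sub>C complex) set \<Rightarrow> ('q::topological_space \<Rightarrow>\<^sub>C complex) set \<Rightarrow>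
     (('k \<Rightarrow>\<^sub>C complex) \<Rightarrow> ('q \<Rightarrow>\<^sub>C complex)) \<Rightarrow> bool" where
  "unital_algebra_hom A B \<psi> \<longleftrightarrow>
     clinear_on A \<psi> \<and> \<psi> ` A \<subseteq> B \<and>
     (\<forall>f\<in>A. \<forall>g\<in>A. \<psi> (f * g) = \<psi> f * \<psi> g) \<and> \<psi> 1 = 1"

end

theory Submission
  imports Defs "HOL-Complex_Analysis.Complex_Analysis"
begin

text \<open>
  The vector field \<open>1 - z\<^sup>2\<close> is tangent to the unit sphere of \<open>A\<close>, so a surjective isometry \<open>S\<close>
  carries it to the tangent field \<open>S 1 - S ((S\<^sup>-\<^sup>1 x)\<^sup>2)\<close> of \<open>B\<close>. Tangency at \<open>x = 1\<close>
  and extremality of \<open>1\<close> show that \<open>S 1\<close> is unimodular with inverse in \<open>B\<close>. If \<open>S 1 = 1\<close>, the difference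
  \<open>x\<^sup>2 - S ((S\<^sup>-\<^sup>1 x)\<^sup>2)\<close> of two tangent fields is homogeneous of degree 2 and tangent, hence zero.
  So \<open>S (f g) S 1 = S f S g\<close> for every surjective isometry \<open>S\<close>.

  In particular \<open>S (exp f)\<close> never vanishes, so neither does \<open>T (exp f)\<close> for a weak-local isometry \<open>T\<close>. As in
  the Gleason--Kahane--Zelazko theorem, \<open>z \<mapsto> T (exp (z f)) s\<close> is a zero-free entire function of
  exponential type, thus of the form \<open>exp (\<alpha> + \<beta> z)\<close>, and its Taylor coefficients give
  \<open>T (f g) T 1 = T f T g\<close>.

  It remains to see that the conjugate of \<open>u = T 1\<close> lies in \<open>B\<close>. The weak-local property for \<open>\<delta>\<^sub>s - \<delta>\<^sub>t\<close>
  shows that \<open>u\<close> does not separate points that the self-adjoint part of \<open>B\<close> does not separate;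
  by Stone--Weierstrass \<open>u\<close> belongs to that part.
\<close>

section \<open>Pointwise rules, norms and closure properties\<close>

lemmas [simp] = times_bcontfun.rep_eq one_bcontfun.rep_eq scaleC_bcontfun.rep_eq

lemma power_bcontfun_apply [simp]:
  "apply_bcontfun (f ^ n) s = apply_bcontfun f s ^ n"
  for f :: "'k::topological_space \<Rightarrow>\<^sub>C complex"
  by (induction n) auto

lemma sum_bcontfun_apply [simp]:
  "apply_bcontfun (\<Sum>i\<in>I. f i) s = (\<Sum>i\<in>I. apply_bcontfun (f i) s)"
  for f :: "'i \<Rightarrow> 'k::topological_space \<Rightarrow>\<^sub>C complex"
  by (induction I rule: infinite_finite_induct) auto

lemma norm_scaleC: "norm (c *\<^sub>C f) = cmod c * norm f"
  for f :: "'k::topological_space \<Rightarrow>\<^sub>C complex"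
proof -
  have le: "norm (c *\<^sub>C f) \<le> cmod c * norm f" for c and f :: "'k \<Rightarrow>\<^sub>C complex"
    by (rule norm_bound) (auto simp: norm_mult intro!: mult_left_mono norm_bounded)
  show ?thesis
  proof (cases "c = 0")
    case True
    then show ?thesis using le[of c f] by simp
  next
    case False
    have "inverse c *\<^sub>C c *\<^sub>C f = f"
      using False by (intro bcontfun_eqI) simp
    then have "norm f \<le> cmod (inverse c) * norm (c *\<^sub>C f)"
      using le[of "inverse c" "c *\<^sub>C f"] by simp
    then have "cmod c * norm f \<le> norm (c *\<^sub>C f)"
      using False by (simp add: norm_divide field_simps)
    with le[of c f] show ?thesis by simp
  qed
qed

lemma norm_square_bcontfun: "norm (f * f) = norm f ^ 2"
  for f :: "'k::topological_space \<Rightarrow>\<^sub>C complex"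
proof (rule antisym)
  show "norm (f * f) \<le> norm f ^ 2"
    using norm_mult_ineq[of f f] by (simp add: power2_eq_square)
  have "norm f \<le> sqrt (norm (f * f))"
  proof (rule norm_bound)
    fix s
    have "cmod (f s) ^ 2 \<le> norm (f * f)"
      using norm_bounded[of "f * f" s] by (simp add: norm_mult power2_eq_square)
    then show "cmod (f s) \<le> sqrt (norm (f * f))"
      by (simp add: real_le_rsqrt)
  qed
  then show "norm f ^ 2 \<le> norm (f * f)"
    using power_mono[of "norm f" "sqrt (norm (f * f))" 2] by simp
qed

lemma uniform_algebraD:
  fixes A :: "('k::t2_space \<Rightarrow>\<^sub>C complex) set"
  assumes "uniform_algebra A"
  shows "compact (UNIV :: 'k set)" and "closed A"
    and "f \<in> A \<Longrightarrow> g \<in> A \<Longrightarrow> f + g \<in> A"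
    and "f \<in> A \<Longrightarrow> c *\<^sub>C f \<in> A"
    and "f \<in> A \<Longrightarrow> g \<in> A \<Longrightarrow> f * g \<in> A"
    and "const_bcontfun c \<in> A"
    and "(1 :: 'k \<Rightarrow>\<^sub>C complex) \<in> A"
    and "f \<in> A \<Longrightarrow> g \<in> A \<Longrightarrow> f - g \<in> A"
    and "f \<in> A \<Longrightarrow> f ^ n \<in> A"
    and "(\<And>i. i \<in> I \<Longrightarrow> h i \<in> A) \<Longrightarrow> (\<Sum>i\<in>I. h i) \<in> A"
proof -
  show "compact (UNIV :: 'k set)" "closed A"
    using assms unfolding uniform_algebra_def by blast+
  have add: "f + g \<in> A" if "f \<in> A" "g \<in> A" for f g
    using assms that unfolding uniform_algebra_def by blast
  have scale: "c *\<^sub>C f \<in> A" if "f \<in> A" for c f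
    using assms that unfolding uniform_algebra_def by blast
  have mult: "f * g \<in> A" if "f \<in> A" "g \<in> A" for f g
    using assms that unfolding uniform_algebra_def by blast
  have const: "const_bcontfun c \<in> A" for c
    using assms unfolding uniform_algebra_def by blast
  have "(1 :: 'k \<Rightarrow>\<^sub>C complex) = const_bcontfun 1" "(0 :: 'k \<Rightarrow>\<^sub>C complex) = const_bcontfun 0"
    by (auto intro: bcontfun_eqI)
  then have one: "(1 :: 'k \<Rightarrow>\<^sub>C complex) \<in> A" and zero: "(0 :: 'k \<Rightarrow>\<^sub>C complex) \<in> A"
    using const by metis+
  have minus: "f - g = f + (-1) *\<^sub>C g" for f g :: "'k \<Rightarrow>\<^sub>C complex"
    by (rule bcontfun_eqI) simp
  show "f \<in> A \<Longrightarrow> g \<in> A \<Longrightarrow> f + g \<in> A" "f \<in> A \<Longrightarrow> c *\<^sub>C f \<in> A"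
    "f \<in> A \<Longrightarrow> g \<in> A \<Longrightarrow> f * g \<in> A" "const_bcontfun c \<in> A" "(1 :: 'k \<Rightarrow>\<^sub>C complex) \<in> A"
    by (fact add scale mult const one)+
  show "f \<in> A \<Longrightarrow> g \<in> A \<Longrightarrow> f - g \<in> A"
    unfolding minus by (intro add scale)
  show "f \<in> A \<Longrightarrow> f ^ n \<in> A"
    by (induction n) (auto simp: one mult)
  show "(\<And>i. i \<in> I \<Longrightarrow> h i \<in> A) \<Longrightarrow> (\<Sum>i\<in>I. h i) \<in> A"
    by (induction I rule: infinite_finite_induct) (auto simp: zero add)
qed

lemma clinear_onD:
  assumes "clinear_on A T" and "uniform_algebra A"
  shows "f \<in> A \<Longrightarrow> g \<in> A \<Longrightarrow> T (f + g) = T f + T g"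
    and "f \<in> A \<Longrightarrow> T (c *\<^sub>C f) = c *\<^sub>C T f"
    and "f \<in> A \<Longrightarrow> g \<in> A \<Longrightarrow> T (f - g) = T f - T g"
    and "T 0 = 0"
proof -
  show add: "f \<in> A \<Longrightarrow> g \<in> A \<Longrightarrow> T (f + g) = T f + T g"
    and scale: "f \<in> A \<Longrightarrow> T (c *\<^sub>C f) = c *\<^sub>C T f" for f g c
    using assms(1) by (auto simp: clinear_on_def)
  have minus: "f - g = f + (-1) *\<^sub>C g" for f g :: "'c::topological_space \<Rightarrow>\<^sub>C complex"
    by (rule bcontfun_eqI) simp
  show "f \<in> A \<Longrightarrow> g \<in> A \<Longrightarrow> T (f - g) = T f - T g"
    using add[of f "(-1) *\<^sub>C g"] scale[of g "-1"] uniform_algebraD(4)[OF assms(2)]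
    by (simp add: minus)
  have "0 = (0::complex) *\<^sub>C (1 :: 'a \<Rightarrow>\<^sub>C complex)"
    by (rule bcontfun_eqI) simp
  then have "T 0 = 0 *\<^sub>C T 1"
    using scale[OF uniform_algebraD(7)[OF assms(2)], of 0] by simp
  then show "T 0 = 0"
    by (intro bcontfun_eqI) simp
qed

lemma surj_lin_isometriesD:
  assumes "S \<in> surj_lin_isometries A B" and "uniform_algebra A"
  shows "clinear_on A S" and "f \<in> A \<Longrightarrow> S f \<in> B"
    and "f \<in> A \<Longrightarrow> norm (S f) = norm f"
    and "g \<in> B \<Longrightarrow> inv_into A S g \<in> A" and "g \<in> B \<Longrightarrow> S (inv_into A S g) = g"
    and "f \<in> A \<Longrightarrow> inv_into A S (S f) = f"
proof -
  show lin: "clinear_on A S" and "f \<in> A \<Longrightarrow> S f \<in> B"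
    and "g \<in> B \<Longrightarrow> inv_into A S g \<in> A" and "g \<in> B \<Longrightarrow> S (inv_into A S g) = g"
    using assms(1) by (auto simp: surj_lin_isometries_def intro: inv_into_into f_inv_into_f)
  have dist: "f \<in> A \<Longrightarrow> g \<in> A \<Longrightarrow> dist (S f) (S g) = dist f g" for f g
    using assms(1) by (auto simp: surj_lin_isometries_def)
  have "0 \<in> A"
    using uniform_algebraD(8)[OF assms(2) uniform_algebraD(7)[OF assms(2)] uniform_algebraD(7)[OF assms(2)]]
    by simp
  then show "f \<in> A \<Longrightarrow> norm (S f) = norm f"
    using dist[of f 0] clinear_onD(4)[OF lin assms(2)] by (simp add: dist_norm)
  have "inj_on S A"
    by (metis dist inj_onI zero_less_dist_iff)
  then show "f \<in> A \<Longrightarrow> inv_into A S (S f) = f"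
    by (rule inv_into_f_f)
qed

section \<open>Tangent vector fields on the unit ball\<close>

text \<open>On the unit circle \<open>1 - z^2\<close> is a real multiple of \<open>\<i> * z\<close>,
  so a step of size \<open>t\<close> leaves the disc only to second order. At interior points the
  first-order term \<open>2 * t * x * d\<close> is absorbed by the defect \<open>d\<close>.\<close>

lemma cmod_moebius_le:
  fixes z :: complex and t :: real
  assumes "cmod z \<le> 1" and "\<bar>t\<bar> \<le> 1/2"
  shows "cmod (z + t * (1 - z\<^sup>2)) \<le> 1 + 2 * t\<^sup>2"
proof -
  obtain x y where z: "z = Complex x y" by (cases z)
  define d where "d = 1 - (x\<^sup>2 + y\<^sup>2)"
  have d: "d \<ge> 0"
    using assms(1) by (simp add: z d_def cmod_def real_sqrt_le_1_iff)
  have x: "\<bar>x\<bar> \<le> 1"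
    using abs_Re_le_cmod[of z] assms(1) by (simp add: z)
  have "\<bar>2 * t\<bar> * \<bar>x\<bar> \<le> 1 * 1"
    using assms(2) x by (intro mult_mono) auto
  then have "2 * t * x \<le> 1"
    using abs_ge_self[of "2 * t * x"] by (simp only: abs_mult[symmetric])
  then have "2 * t * x * d \<le> d"
    using mult_right_mono[OF _ d, of "2 * t * x" 1] by simp
  moreover have "cmod (1 - z\<^sup>2) \<le> 2"
    using norm_triangle_ineq4[of 1 "z\<^sup>2"] power_le_one[OF norm_ge_zero assms(1), of 2]
    by (simp add: norm_power)
  then have "t\<^sup>2 * (cmod (1 - z\<^sup>2))\<^sup>2 \<le> t\<^sup>2 * 2\<^sup>2"
    by (intro mult_left_mono power_mono) auto
  moreover have "(cmod (z + t * (1 - z\<^sup>2)))\<^sup>2 = 1 - d + 2 * t * x * d + t\<^sup>2 * (cmod (1 - z\<^sup>2))\<^sup>2"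
    unfolding cmod_power2 by (simp add: z d_def power2_eq_square) algebra
  ultimately have "(cmod (z + t * (1 - z\<^sup>2)))\<^sup>2 \<le> 1 + 4 * t\<^sup>2"
    by simp
  also have "\<dots> \<le> (1 + 2 * t\<^sup>2)\<^sup>2"
    by (simp add: power2_sum)
  finally show ?thesis
    by (rule power2_le_imp_le) simp
qed

text \<open>A step \<open>t\<close> along \<open>1 - q\<close> followed by a step \<open>-t\<close>
  along \<open>1 - y^2\<close> moves \<open>x\<close> by \<open>t * (x^2 - q)\<close> up to second
  order. The intermediate point \<open>y\<close> may leave the disc, so the second step starts from
  the rescaled point \<open>y'\<close>.\<close>

lemma cmod_moebius_compose_le:
  fixes x q :: complex and t :: real
  assumes x: "cmod x \<le> 1" and q: "cmod q \<le> 1" and t: "\<bar>t\<bar> \<le> 1/2"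
    and y: "cmod (x + t * (1 - q)) \<le> 1 + 2 * t\<^sup>2"
  shows "cmod (x + t * (x\<^sup>2 - q)) \<le> 1 + 13 * t\<^sup>2"
proof -
  define r where "r = 1 + 2 * t\<^sup>2"
  define e where "e = 1 - q"
  define y where "y = x + t * e"
  define y' where "y' = y / r"
  have t2: "t\<^sup>2 \<le> 1/4"
    using power_mono[OF t, of 2] by (simp add: power2_eq_square)
  have r: "r \<ge> 1" "r \<le> 3/2"
    using t2 by (auto simp: r_def)
  have yr: "cmod y \<le> r"
    using y by (simp add: y_def e_def r_def)
  have e: "cmod e \<le> 2"
    using norm_triangle_ineq4[of 1 q] q by (simp add: e_def)
  have y': "cmod y' \<le> 1"
    using yr r by (simp add: y'_def norm_divide)
  have y_eq: "y = r * y'"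
    using r by (simp add: y'_def)
  have diff: "cmod (y - y') \<le> 2 * t\<^sup>2"
  proof -
    have "y - y' = of_real (r - 1) * y'" by (simp add: y_eq algebra_simps)
    then have "cmod (y - y') = \<bar>r - 1\<bar> * cmod y'"
      by (simp only: norm_mult norm_of_real)
    then have "cmod (y - y') = (r - 1) * cmod y'"
      using r by simp
    also have "\<dots> \<le> (r - 1) * 1" using y' r by (intro mult_left_mono) auto
    finally show ?thesis by (simp add: r_def)
  qed
  have sum: "cmod (y + y') \<le> 5/2"
    using norm_triangle_ineq[of y y'] yr r y' by linarith
  have 1: "cmod (t * ((y - y') * (y + y'))) \<le> 1/2 * (2 * t\<^sup>2 * (5/2))"
    unfolding norm_mult using t diff sum by (intro mult_mono) auto
  have 2: "cmod (y' + (-t) * (1 - y'\<^sup>2)) \<le> 1 + 2 * t\<^sup>2"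
    using cmod_moebius_le[OF y', of "-t"] t by simp
  have 3: "cmod (2 * t\<^sup>2 * x * e) \<le> 2 * t\<^sup>2 * 1 * 2"
    unfolding norm_mult using x e by (intro mult_mono) (auto simp: norm_power)
  have 4: "cmod (t\<^sup>2 * (t * (e * e))) \<le> t\<^sup>2 * (1/2 * (2 * 2))"
    unfolding norm_mult using t e by (intro mult_mono) (auto simp: norm_power)
  \<comment> \<open>The first summand is the second step; the others correct for the rescaling and
    for \<open>y^2\<close> in place of \<open>x^2\<close>.\<close>
  have eq: "x + t * (x\<^sup>2 - q) = (y' + (-t) * (1 - y'\<^sup>2)) + (y - y') + t * ((y - y') * (y + y'))
      - 2 * t\<^sup>2 * x * e - t\<^sup>2 * (t * (e * e))"
    by (simp add: y_def e_def power2_eq_square algebra_simps)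
  have "cmod (a + b + c - d - f) \<le> cmod a + cmod b + cmod c + cmod d + cmod f" for a b c d f
    by (smt (verit) norm_triangle_ineq norm_triangle_ineq4)
  note this[of "y' + (-t) * (1 - y'\<^sup>2)" "y - y'" "t * ((y - y') * (y + y'))" "2 * t\<^sup>2 * x * e"
      "t\<^sup>2 * (t * (e * e))", folded eq]
  with 1 2 3 4 diff show ?thesis
    using zero_le_power2[of t] by linarith
qed

text \<open>The scalar estimate holds pointwise for the preimage \<open>f\<close> of
  \<open>x\<close>, hence in norm; \<open>S\<close> carries it to \<open>B\<close>.\<close>

lemma isometry_moebius_le:
  fixes S :: "('k::t2_space \<Rightarrow>\<^sub>C complex) \<Rightarrow> ('q::t2_space \<Rightarrow>\<^sub>C complex)"
    and t :: real
  assumes A: "uniform_algebra A" and S: "S \<in> surj_lin_isometries A B"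
    and x: "x \<in> B" "norm x \<le> 1" and t: "\<bar>t\<bar> \<le> 1/2"
  shows "cmod (x s + of_real t * (S 1 s - S (inv_into A S x * inv_into A S x) s)) \<le> 1 + 2 * t\<^sup>2"
proof -
  note A' = uniform_algebraD[OF A] and S' = surj_lin_isometriesD[OF S A]
  note lin = clinear_onD[OF S'(1) A]
  define f where "f = inv_into A S x"
  have f: "f \<in> A" "S f = x" and nf: "norm f \<le> 1"
    using S'(4,5)[OF x(1)] S'(3)[of f] x(2) by (auto simp: f_def)
  define g where "g = f + complex_of_real t *\<^sub>C (1 - f * f)"
  have g: "g \<in> A"
    unfolding g_def using f by (intro A')
  have Sg: "S g = x + complex_of_real t *\<^sub>C (S 1 - S (f * f))"
    using f A' by (simp add: g_def lin)
  have "norm g \<le> 1 + 2 * t\<^sup>2"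
  proof (rule norm_bound)
    fix s
    have "cmod (f s) \<le> 1"
      using norm_bounded[of f s] nf by linarith
    from cmod_moebius_le[OF this t] show "cmod (g s) \<le> 1 + 2 * t\<^sup>2"
      by (simp add: g_def power2_eq_square)
  qed
  then have "norm (S g) \<le> 1 + 2 * t\<^sup>2"
    using S'(3)[OF g] by simp
  from order_trans[OF norm_bounded this, of s] show ?thesis
    by (simp add: Sg flip: f_def)
qed

text \<open>Moving from \<open>1\<close> along \<open>z\<close> changes the modulus by
  \<open>t * Re z\<close> to first order, which a bound quadratic in \<open>t\<close>
  excludes.\<close>

lemma Re_eq_0_if_cmod_le:
  fixes z :: complex
  assumes "\<And>t::real. \<bar>t\<bar> \<le> 1/2 \<Longrightarrow> cmod (1 + t * z) \<le> 1 + 2 * t\<^sup>2"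
  shows "Re z = 0"
proof (rule ccontr)
  assume "Re z \<noteq> 0"
  define t where "t = sgn (Re z) * min (1/2) (\<bar>Re z\<bar> / 4)"
  have t: "\<bar>t\<bar> = min (1/2) (\<bar>Re z\<bar> / 4)" "t * Re z = \<bar>t\<bar> * \<bar>Re z\<bar>"
    using \<open>Re z \<noteq> 0\<close> by (auto simp: t_def abs_mult sgn_if)
  have "1 + t * Re z \<le> cmod (1 + t * z)"
    using complex_Re_le_cmod[of "1 + t * z"] by simp
  also have "\<dots> \<le> 1 + 2 * t\<^sup>2"
    using t by (intro assms) auto
  finally have "\<bar>t\<bar> * \<bar>Re z\<bar> \<le> \<bar>t\<bar> * (2 * \<bar>t\<bar>)"
    unfolding t(2) by (simp add: power2_eq_square)
  moreover have "\<bar>t\<bar> > 0"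
    unfolding t(1) using \<open>Re z \<noteq> 0\<close> by simp
  ultimately have "\<bar>Re z\<bar> \<le> 2 * \<bar>t\<bar>"
    by simp
  then show False
    using t(1) \<open>Re z \<noteq> 0\<close> by linarith
qed

section \<open>Unimodularity of the image of the constant \<open>1\<close>\<close>

text \<open>With \<open>a\<close> the preimage of \<open>1\<close>, the candidate is
  \<open>q = S (a * a)\<close>: tangency at \<open>1\<close> and at \<open>\<i>\<close> compares the
  real and imaginary parts of \<open>S 1\<close> and \<open>q\<close>. Once \<open>q\<close> is the
  conjugate of \<open>S 1\<close>, the function \<open>1 - S 1 * q\<close> lies in \<open>B\<close>
  and can be tested against extremality.\<close>

lemma isometry_one_unimodular:
  fixes S :: "('k::t2_space \<Rightarrow>\<^sub>C complex) \<Rightarrow> ('q::t2_space \<Rightarrow>\<^sub>C complex)"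
  assumes A: "uniform_algebra A" and B: "uniform_algebra B"
    and S: "S \<in> surj_lin_isometries A B"
  obtains q where "q \<in> B" and "\<And>s. q s = cnj (S 1 s)" and "S 1 * q = 1"
proof -
  note A' = uniform_algebraD[OF A] and B' = uniform_algebraD[OF B]
  note S' = surj_lin_isometriesD[OF S A]
  note lin = clinear_onD[OF S'(1) A]
  define u where "u = S 1"
  define a where "a = inv_into A S 1"
  have a: "a \<in> A" "S a = 1"
    using S'(4,5)[OF B'(7)] by (auto simp: a_def)
  define q where "q = S (a * a)"
  have u: "u \<in> B" "norm u = 1" and q: "q \<in> B"
    using S'(2,3) A' a by (auto simp: u_def q_def)
  have q_eq: "q s = cnj (u s)" for s
  proof -
    have 1: "cmod (1 + of_real t * (u s - q s)) \<le> 1 + 2 * t\<^sup>2" if "\<bar>t\<bar> \<le> 1/2" for t :: real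
      using isometry_moebius_le[OF A S B'(7) _ that, of s]
      by (simp add: u_def q_def flip: a_def)
    have re: "Re (u s - q s) = 0"
      by (rule Re_eq_0_if_cmod_le) (rule 1)
    \<comment> \<open>At \<open>x = \<i>\<close> the preimage is \<open>\<i> *\<^sub>C a\<close>,
      whose square is minus that of \<open>a\<close>, so the field takes the value
      \<open>u + q\<close>. The factor \<open>- \<i>\<close> then rotates the base point back to
      \<open>1\<close>.\<close>
    have ia: "inv_into A S (\<i> *\<^sub>C 1) = \<i> *\<^sub>C a"
      using S'(6)[of "\<i> *\<^sub>C a"] a A' by (simp add: lin)
    have "(\<i> *\<^sub>C a) * (\<i> *\<^sub>C a) = (-1) *\<^sub>C (a * a)"
      by (rule bcontfun_eqI) (simp add: algebra_simps)
    then have iq: "S ((\<i> *\<^sub>C a) * (\<i> *\<^sub>C a)) = (-1) *\<^sub>C q"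
      using a A' by (simp add: lin q_def)
    have 2: "cmod (1 + of_real t * (- \<i> * (u s + q s))) \<le> 1 + 2 * t\<^sup>2" if "\<bar>t\<bar> \<le> 1/2" for t :: real
    proof -
      have "cmod (\<i> + of_real t * (u s + q s)) \<le> 1 + 2 * t\<^sup>2"
        using isometry_moebius_le[OF A S B'(4)[OF B'(7), of \<i>] _ that, of s]
        by (simp add: ia iq norm_scaleC u_def)
      moreover have "1 + of_real t * (- \<i> * (u s + q s)) = - \<i> * (\<i> + of_real t * (u s + q s))"
        by (simp add: algebra_simps)
      ultimately show ?thesis
        by (simp only: norm_mult) simp
    qed
    have "Re (- \<i> * (u s + q s)) = 0"
      by (rule Re_eq_0_if_cmod_le) (rule 2)
    with re show ?thesis
      by (simp add: complex_eq_iff)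
  qed
  \<comment> \<open>\<open>u = S 1\<close> is an extreme point of the unit ball, but \<open>u \<plusminus> (1 - \<bar>u\<bar>\<^sup>2) / 2\<close> lies in that ball.\<close>
  define h where "h = (1/2) *\<^sub>C (1 - u * q)"
  have h_eq: "h s = of_real ((1 - (cmod (u s))\<^sup>2) / 2)" for s
    by (simp add: h_def q_eq complex_norm_square[symmetric])
  have h: "h \<in> B"
    unfolding h_def using u q by (intro B')
  have us: "cmod (u s) \<le> 1" for s
    using norm_bounded[of u s] u by simp
  have uh: "cmod (u s) + cmod (h s) \<le> 1" for s
  proof -
    have "cmod (h s) = (1 - (cmod (u s))\<^sup>2) / 2"
      unfolding h_eq norm_of_real using power_le_one[OF norm_ge_zero us[of s], of 2] by simp
    moreover have "0 \<le> (1 - cmod (u s))\<^sup>2"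
      by simp
    ultimately show ?thesis
      by (simp add: power2_eq_square algebra_simps)
  qed
  have plus: "norm (u + h) \<le> 1"
    by (rule norm_bound) (simp add: order_trans[OF norm_triangle_ineq uh])
  have minus: "norm (u - h) \<le> 1"
    by (rule norm_bound) (simp add: order_trans[OF norm_triangle_ineq4 uh])
  define g where "g = inv_into A S h"
  have g: "g \<in> A" "S g = h"
    using S'(4,5)[OF h] by (auto simp: g_def)
  have "norm (1 + g) \<le> 1" "norm (1 - g) \<le> 1"
    using S'(3)[OF A'(3)[OF A'(7) g(1)]] S'(3)[OF A'(8)[OF A'(7) g(1)]] g A'(7) plus minus
    by (auto simp: lin u_def)
  have "g s = 0" for s
  proof -
    have "cmod (1 + g s) \<le> 1" "cmod (1 - g s) \<le> 1"
      using \<open>norm (1 + g) \<le> 1\<close> \<open>norm (1 - g) \<le> 1\<close> norm_bounded[of "1 + g" s] norm_bounded[of "1 - g" s]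
      by auto
    then have "(cmod (1 + g s))\<^sup>2 \<le> 1" "(cmod (1 - g s))\<^sup>2 \<le> 1"
      by (auto intro: power_le_one)
    moreover have "(cmod (1 + g s))\<^sup>2 + (cmod (1 - g s))\<^sup>2 = 2 + 2 * (cmod (g s))\<^sup>2"
      unfolding cmod_power2 by (simp add: power2_eq_square algebra_simps)
    ultimately have "(cmod (g s))\<^sup>2 \<le> 0"
      by linarith
    then show ?thesis
      by simp
  qed
  then have "g = 0"
    by (intro bcontfun_eqI) simp
  then have "h = 0"
    using g lin(4) by simp
  have "(u * q) s = apply_bcontfun 1 s" for s
  proof -
    have "h s = 0" using \<open>h = 0\<close> by simp
    then show ?thesis by (simp add: h_def)
  qed
  then have "u * q = 1"
    by (rule bcontfun_eqI)
  with q q_eq show ?thesis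
    by (intro that[of q]) (auto simp: u_def)
qed

section \<open>Homogeneous tangent fields of degree 2 vanish\<close>

text \<open>Polynomials in \<open>z\<close> with coefficients in \<open>B\<close>, generated in
  Horner style, so that holomorphy and closure under bilinear maps follow by induction without
  handling coefficients.\<close>

inductive_set vector_poly ::
    "('q::topological_space \<Rightarrow>\<^sub>C complex) set \<Rightarrow> (complex \<Rightarrow> 'q \<Rightarrow>\<^sub>C complex) set"
  for B where
  const: "x \<in> B \<Longrightarrow> (\<lambda>_. x) \<in> vector_poly B"
| add: "p \<in> vector_poly B \<Longrightarrow> q \<in> vector_poly B \<Longrightarrow> (\<lambda>z. p z + q z) \<in> vector_poly B"
| shift: "p \<in> vector_poly B \<Longrightarrow> (\<lambda>z. z *\<^sub>C p z) \<in> vector_poly B"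

lemma holomorphic_vector_poly:
  "p \<in> vector_poly B \<Longrightarrow> (\<lambda>z. apply_bcontfun (p z) s) holomorphic_on UNIV"
  by (induction rule: vector_poly.induct) (auto intro!: holomorphic_intros)

text \<open>The later instance is \<open>b x y = x * y - S (G x * G y)\<close> with \<open>G\<close>
  the inverse of \<open>S\<close>, the polarised difference of two tangent fields.\<close>

locale bilinear_on =
  fixes B :: "('q::topological_space \<Rightarrow>\<^sub>C complex) set"
    and b :: "('q \<Rightarrow>\<^sub>C complex) \<Rightarrow> ('q \<Rightarrow>\<^sub>C complex) \<Rightarrow> 'q \<Rightarrow>\<^sub>C complex"
  assumes add_closed: "x \<in> B \<Longrightarrow> y \<in> B \<Longrightarrow> x + y \<in> B"
    and scale_closed: "x \<in> B \<Longrightarrow> c *\<^sub>C x \<in> B"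
    and closed: "x \<in> B \<Longrightarrow> y \<in> B \<Longrightarrow> b x y \<in> B"
    and add_left: "x \<in> B \<Longrightarrow> y \<in> B \<Longrightarrow> z \<in> B \<Longrightarrow> b (x + y) z = b x z + b y z"
    and add_right: "x \<in> B \<Longrightarrow> y \<in> B \<Longrightarrow> z \<in> B \<Longrightarrow> b x (y + z) = b x y + b x z"
    and scale_left: "x \<in> B \<Longrightarrow> y \<in> B \<Longrightarrow> b (c *\<^sub>C x) y = c *\<^sub>C b x y"
    and scale_right: "x \<in> B \<Longrightarrow> y \<in> B \<Longrightarrow> b x (c *\<^sub>C y) = c *\<^sub>C b x y"
begin

lemma vector_poly_in: "p \<in> vector_poly B \<Longrightarrow> p z \<in> B"
  by (induction rule: vector_poly.induct) (auto simp: add_closed scale_closed)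

lemma vector_poly_bilinear:
  assumes p: "p \<in> vector_poly B" and q: "q \<in> vector_poly B"
  shows "(\<lambda>z. b (p z) (q z)) \<in> vector_poly B"
  using p
proof induction
  case (const x)
  show ?case
    using q
  proof induction
    case (const y)
    then show ?case using \<open>x \<in> B\<close> by (intro vector_poly.const closed)
  next
    case (add q1 q2)
    then show ?case
      using vector_poly.add[OF add.IH] \<open>x \<in> B\<close> by (simp add: vector_poly_in add_right)
  next
    case (shift q)
    then show ?case
      using vector_poly.shift[OF shift.IH] \<open>x \<in> B\<close> by (simp add: vector_poly_in scale_right)
  qed
next
  case (add p1 p2)
  then show ?case
    using vector_poly.add[OF add.IH] by (simp add: vector_poly_in q add_left)
next
  case (shift p)
  then show ?case
    using vector_poly.shift[OF shift.IH] by (simp add: vector_poly_in q scale_left)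
qed

text \<open>Each Euler step adds \<open>z *\<^sub>C b x x\<close> to first order. Only the linear
  coefficient of the iterate matters; the higher terms are absorbed in \<open>r\<close>.\<close>

lemma iterate_eq:
  assumes x: "x \<in> B"
  shows "\<exists>r\<in>vector_poly B. \<forall>z. ((\<lambda>y. y + z *\<^sub>C b y y) ^^ k) x =
      x + z *\<^sub>C (of_nat k *\<^sub>C b x x + z *\<^sub>C r z)"
proof (induction k)
  case 0
  have "(\<lambda>_. 0 *\<^sub>C x) \<in> vector_poly B"
    using x by (intro vector_poly.const scale_closed)
  then show ?case
    by (rule bexI[rotated]) (auto intro!: bcontfun_eqI)
next
  case (Suc k)
  then obtain r where r: "r \<in> vector_poly B"
    and eq: "\<And>z. ((\<lambda>y. y + z *\<^sub>C b y y) ^^ k) x = x + z *\<^sub>C (of_nat k *\<^sub>C b x x + z *\<^sub>C r z)"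
    by blast
  define q where "q = (\<lambda>z. of_nat k *\<^sub>C b x x + z *\<^sub>C r z)"
  have q: "q \<in> vector_poly B"
    unfolding q_def using r x by (intro vector_poly.intros scale_closed closed)
  define r' where "r' = (\<lambda>z. r z + ((b x (q z) + b (q z) x) + z *\<^sub>C b (q z) (q z)))"
  have "r' \<in> vector_poly B"
    unfolding r'_def using r q x
    by (intro vector_poly.add vector_poly.shift vector_poly_bilinear vector_poly.const)
  moreover have "((\<lambda>y. y + z *\<^sub>C b y y) ^^ Suc k) x = x + z *\<^sub>C (of_nat (Suc k) *\<^sub>C b x x + z *\<^sub>C r' z)"
    for z
  proof -
    have qz: "q z \<in> B" using q by (rule vector_poly_in)
    have "b (x + z *\<^sub>C q z) (x + z *\<^sub>C q z) =
        b x x + z *\<^sub>C ((b x (q z) + b (q z) x) + z *\<^sub>C b (q z) (q z))"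
      using x qz
      by (auto simp: add_left add_right scale_left scale_right add_closed scale_closed algebra_simps
          intro!: bcontfun_eqI)
    moreover have "((\<lambda>y. y + z *\<^sub>C b y y) ^^ k) x = x + z *\<^sub>C q z"
      by (simp add: eq q_def)
    ultimately show ?thesis
      by (auto simp: r'_def q_def algebra_simps intro!: bcontfun_eqI)
  qed
  ultimately show ?case by blast
qed

text \<open>
  The hypothesis says that \<open>x \<mapsto> b x x\<close> is tangent to the unit sphere, so its flow stays in the unit
  ball for all complex times; by Liouville, it is stationary. The proof replaces the flow by
  its Euler approximation, which is polynomial in the time step.
\<close>

lemma square_eq_0_if_tangent:
  assumes "C \<ge> 0"
    and bound: "\<And>x \<epsilon>. x \<in> B \<Longrightarrow> norm x \<le> 1 \<Longrightarrow> cmod \<epsilon> \<le> 1/2 \<Longrightarrow>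
      norm (x + \<epsilon> *\<^sub>C b x x) \<le> 1 + C * (cmod \<epsilon>)\<^sup>2"
    and x: "x \<in> B" "norm x \<le> 1"
  shows "b x x = 0"
proof (rule bcontfun_eqI)
  fix s
  \<comment> \<open>Homogeneity of degree 2: a step \<open>\<epsilon>\<close> at radius
    \<open>M\<close> is \<open>M\<close> times a step \<open>\<epsilon> * M\<close> in the unit
    ball.\<close>
  have scaled: "norm (y + \<epsilon> *\<^sub>C b y y) \<le> M * (1 + C * (cmod \<epsilon> * M)\<^sup>2)"
    if y: "y \<in> B" "norm y \<le> M" and M: "M > 0" "cmod \<epsilon> * M \<le> 1/2" for y \<epsilon> M
  proof -
    define y' where "y' = of_real (1 / M) *\<^sub>C y"
    have y': "y' \<in> B" "norm y' \<le> 1"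
      using y M by (auto simp: y'_def scale_closed norm_scaleC norm_divide)
    have y_eq: "y = of_real M *\<^sub>C y'"
      using M by (intro bcontfun_eqI) (simp add: y'_def)
    have "b y y = of_real M *\<^sub>C of_real M *\<^sub>C b y' y'"
      using y' by (simp add: y_eq scale_left scale_right scale_closed)
    then have "y + \<epsilon> *\<^sub>C b y y = of_real M *\<^sub>C (y' + (\<epsilon> * of_real M) *\<^sub>C b y' y')"
      by (auto simp: y_eq algebra_simps intro!: bcontfun_eqI)
    moreover have "norm (y' + (\<epsilon> * of_real M) *\<^sub>C b y' y') \<le> 1 + C * (cmod \<epsilon> * M)\<^sup>2"
      using bound[OF y', of "\<epsilon> * of_real M"] M by (simp add: norm_mult)
    ultimately show ?thesis
      using M by (simp add: norm_scaleC)
  qed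
  have le: "cmod (b x x s) \<le> 2 / R" if R: "R > 0" for R
  proof -
    \<comment> \<open>\<open>n\<close> Euler steps of size \<open>\<rho> = R / n\<close> cover the
      time \<open>R\<close>. The bound by \<open>8 * C * R\<^sup>2\<close> keeps the total growth
      \<open>n * a\<close> at most \<open>1/2\<close>; the bound by \<open>4 * R\<close> makes steps
      at radius up to \<open>2\<close> admissible for \<open>scaled\<close>.\<close>
    obtain n :: nat where n: "n \<ge> max 1 (max (8 * C * R\<^sup>2) (4 * R))"
      using real_arch_simple by blast
    then have n': "n > 0" "8 * C * R\<^sup>2 \<le> n" "4 * R \<le> n" by auto
    define \<rho> where "\<rho> = R / n"
    have \<rho>: "\<rho> > 0" "\<rho> * 2 \<le> 1/2"
      using R n' by (auto simp: \<rho>_def field_simps)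
    define a where "a = 4 * C * \<rho>\<^sup>2"
    have a: "a \<ge> 0" "n * a \<le> 1/2"
    proof -
      show "a \<ge> 0" using \<open>C \<ge> 0\<close> by (simp add: a_def)
      have "n * a = 4 * C * R\<^sup>2 / n"
        using n' by (simp add: a_def \<rho>_def power2_eq_square)
      also have "\<dots> \<le> 1/2"
        using n' by (simp add: field_simps)
      finally show "n * a \<le> 1/2" .
    qed
    define h where "h = (\<lambda>z. apply_bcontfun (((\<lambda>y. y + z *\<^sub>C b y y) ^^ n) x) s)"
    obtain r where r: "r \<in> vector_poly B"
      and eq: "\<And>z. ((\<lambda>y. y + z *\<^sub>C b y y) ^^ n) x = x + z *\<^sub>C (of_nat n *\<^sub>C b x x + z *\<^sub>C r z)"
      using iterate_eq[OF x(1), of n] by blast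
    have h_eq: "h = (\<lambda>z. x s + z * (of_nat n * b x x s + z * r z s))"
      by (simp add: h_def eq fun_eq_iff)
    have hol: "h holomorphic_on UNIV"
      unfolding h_eq using holomorphic_vector_poly[OF r] by (intro holomorphic_intros)
    have "((\<lambda>z. r z s) has_field_derivative deriv (\<lambda>z. r z s) 0) (at 0)"
      using holomorphic_vector_poly[OF r] by (intro holomorphic_derivI) auto
    then have "(h has_field_derivative of_nat n * b x x s) (at 0)"
      unfolding h_eq by (auto intro!: derivative_eq_intros)
    then have deriv: "deriv h 0 = of_nat n * b x x s"
      by (rule DERIV_imp_deriv)
    \<comment> \<open>As long as the norm is at most \<open>2\<close>, a step multiplies its bound
      by at most \<open>1 + a\<close>, and \<open>(1 + a) ^ k \<le> exp (1/2) \<le> 2\<close> keeps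
      it there.\<close>
    have iter: "((\<lambda>y. y + z *\<^sub>C b y y) ^^ k) x \<in> B \<and> norm (((\<lambda>y. y + z *\<^sub>C b y y) ^^ k) x) \<le> (1 + a) ^ k"
      if "k \<le> n" and z: "cmod z = \<rho>" for k z
      using \<open>k \<le> n\<close>
    proof (induction k)
      case 0
      then show ?case using x by simp
    next
      case (Suc k)
      define y where "y = ((\<lambda>y. y + z *\<^sub>C b y y) ^^ k) x"
      have y: "y \<in> B" "norm y \<le> (1 + a) ^ k"
        using Suc by (auto simp: y_def)
      have M: "(1 + a) ^ k \<ge> 1"
        using a by (intro one_le_power) auto
      have "(1 + a) ^ k \<le> exp a ^ k"
        using a by (intro power_mono exp_ge_add_one_self) auto
      also have "\<dots> = exp (k * a)"
        by (simp add: exp_of_nat_mult)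
      also have "\<dots> \<le> exp (1/2)"
        using mult_right_mono[of "real k" "real n" a] Suc.prems a by simp
      finally have M2: "(1 + a) ^ k \<le> 2"
        using exp_half_le2 by linarith
      have "\<rho> * (1 + a) ^ k \<le> \<rho> * 2"
        using M2 \<rho> by (intro mult_left_mono) auto
      then have "cmod z * (1 + a) ^ k \<le> 1/2"
        using \<rho> unfolding z by linarith
      then have "norm (y + z *\<^sub>C b y y) \<le> (1 + a) ^ k * (1 + C * (cmod z * (1 + a) ^ k)\<^sup>2)"
        using y M by (intro scaled) auto
      also have "C * (cmod z * (1 + a) ^ k)\<^sup>2 \<le> C * (\<rho> * 2)\<^sup>2"
        using z \<open>\<rho> * (1 + a) ^ k \<le> \<rho> * 2\<close> \<open>C \<ge> 0\<close> \<rho> M by (intro mult_left_mono power_mono) auto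
      also have "C * (\<rho> * 2)\<^sup>2 = a"
        by (simp add: a_def power2_eq_square)
      finally have "norm (y + z *\<^sub>C b y y) \<le> (1 + a) ^ Suc k"
        using M by (simp add: mult.commute)
      moreover have "y + z *\<^sub>C b y y \<in> B"
        using y by (intro add_closed scale_closed closed)
      ultimately show ?case
        by (simp add: y_def)
    qed
    have "cmod (h z) \<le> 2" if z: "cmod z = \<rho>" for z
    proof -
      have "cmod (h z) \<le> (1 + a) ^ n"
        unfolding h_def using iter[OF order_refl z] norm_bounded order_trans by blast
      also have "\<dots> \<le> exp a ^ n"
        using a by (intro power_mono exp_ge_add_one_self) auto
      also have "\<dots> = exp (n * a)"
        by (simp add: exp_of_nat_mult)
      also have "\<dots> \<le> exp (1/2)"
        using a by simp
      finally show ?thesis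
        using exp_half_le2 by linarith
    qed
    \<comment> \<open>By Cauchy's inequality on the circle of radius \<open>\<rho>\<close>, the
      factor \<open>n\<close> in the derivative cancels against
      \<open>2 / \<rho> = 2 * n / R\<close>, leaving a bound that tends to \<open>0\<close> as
      \<open>R\<close> grows.\<close>
    then have "norm ((deriv ^^ 1) h 0) \<le> fact 1 * 2 / \<rho> ^ 1"
      using \<rho> hol
      by (intro Cauchy_inequality) (auto intro: holomorphic_on_subset holomorphic_on_imp_continuous_on)
    then have "real n * cmod (b x x s) \<le> 2 / \<rho>"
      by (simp add: deriv norm_mult)
    then show ?thesis
      using n' R by (simp add: \<rho>_def field_simps)
  qed
  show "b x x s = apply_bcontfun 0 s"
  proof (rule ccontr)
    assume "b x x s \<noteq> apply_bcontfun 0 s"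
    then have "cmod (b x x s) > 0" by simp
    with le[of "4 / cmod (b x x s)"] show False by simp
  qed
qed

end

section \<open>Multiplicativity of surjective isometries\<close>

text \<open>Both \<open>1 - x * x\<close> and the transported field \<open>1 - S (G x * G x)\<close>
  are tangent to the unit sphere of \<open>B\<close>. Their difference \<open>b x x\<close> is
  homogeneous, so \<open>square_eq_0_if_tangent\<close> applies; the claim is the case
  \<open>x = S f\<close>.\<close>

lemma unital_isometry_square:
  fixes S :: "('k::t2_space \<Rightarrow>\<^sub>C complex) \<Rightarrow> ('q::t2_space \<Rightarrow>\<^sub>C complex)"
  assumes A: "uniform_algebra A" and B: "uniform_algebra B"
    and S: "S \<in> surj_lin_isometries A B" and unit: "S 1 = 1" and f: "f \<in> A"
  shows "S (f * f) = S f * S f"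
proof -
  note A' = uniform_algebraD[OF A] and B' = uniform_algebraD[OF B]
  note S' = surj_lin_isometriesD[OF S A]
  note lin = clinear_onD[OF S'(1) A]
  define G where "G = inv_into A S"
  have G: "G x \<in> A" "S (G x) = x" "norm (G x) = norm x" if "x \<in> B" for x
    using S'(3,4,5) that by (auto simp: G_def) metis
  have GS: "G (S f) = f" if "f \<in> A" for f
    using S'(6) that by (simp add: G_def)
  have G_add: "G (x + y) = G x + G y" if "x \<in> B" "y \<in> B" for x y
    using GS[of "G x + G y"] G that A' by (simp add: lin)
  have G_scale: "G (c *\<^sub>C x) = c *\<^sub>C G x" if "x \<in> B" for c x
    using GS[of "c *\<^sub>C G x"] G that A' by (simp add: lin)
  define b where "b = (\<lambda>x y. x * y - S (G x * G y))"
  have scale_mult: "c *\<^sub>C f * g = c *\<^sub>C (f * g)" "f * c *\<^sub>C g = c *\<^sub>C (f * g)"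
    for c and f g :: "'c::topological_space \<Rightarrow>\<^sub>C complex"
    by (auto intro: bcontfun_eqI)
  have scale_diff: "c *\<^sub>C (f - g) = c *\<^sub>C f - c *\<^sub>C g"
    for c and f g :: "'c::topological_space \<Rightarrow>\<^sub>C complex"
    by (auto simp: algebra_simps intro: bcontfun_eqI)
  interpret bilinear_on B b
    by unfold_locales
      (auto simp: b_def G_add G_scale G scale_mult scale_diff lin A' B' S'(2) algebra_simps)
  have bound: "norm (x + \<epsilon> *\<^sub>C b x x) \<le> 1 + 13 * (cmod \<epsilon>)\<^sup>2"
    if x: "x \<in> B" "norm x \<le> 1" and \<epsilon>: "cmod \<epsilon> \<le> 1/2" for x \<epsilon>
  proof -
    have real: "norm (x + complex_of_real t *\<^sub>C b x x) \<le> 1 + 13 * t\<^sup>2"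
      if x: "x \<in> B" "norm x \<le> 1" and t: "\<bar>t\<bar> \<le> 1/2" for x t
    proof (rule norm_bound)
      fix s
      have 1: "cmod (x s) \<le> 1"
        using norm_bounded[of x s] x by linarith
      have "norm (S (G x * G x)) \<le> 1"
        using G[OF x(1)] x A' S'(3) by (simp add: norm_square_bcontfun power_le_one)
      then have 2: "cmod (S (G x * G x) s) \<le> 1"
        using norm_bounded order_trans by blast
      have "cmod (x s + of_real t * (1 - S (G x * G x) s)) \<le> 1 + 2 * t\<^sup>2"
        using isometry_moebius_le[OF A S x t, of s] by (simp add: unit G_def)
      from cmod_moebius_compose_le[OF 1 2 t this]
      show "cmod ((x + complex_of_real t *\<^sub>C b x x) s) \<le> 1 + 13 * t\<^sup>2"
        by (simp add: b_def power2_eq_square)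
    qed
    \<comment> \<open>So far the steps are real. Since \<open>b x x\<close> is quadratic in
      \<open>x\<close>, the phase \<open>w\<close> of \<open>\<epsilon>\<close> can be moved into
      \<open>x\<close>; for \<open>\<epsilon> = 0\<close> any phase would do.\<close>
    define w where "w = (if \<epsilon> = 0 then 1 else sgn \<epsilon>)"
    have w: "cmod w = 1" "\<epsilon> = of_real (cmod \<epsilon>) * w"
      by (auto simp: w_def sgn_eq norm_divide)
    have wx: "w *\<^sub>C x \<in> B" "norm (w *\<^sub>C x) \<le> 1"
      using x w B' by (auto simp: norm_scaleC)
    have "w *\<^sub>C (x + \<epsilon> *\<^sub>C b x x) = w *\<^sub>C x + complex_of_real (cmod \<epsilon>) *\<^sub>C b (w *\<^sub>C x) (w *\<^sub>C x)"
      using x wx by (subst w(2)) (auto simp: scale_left scale_right algebra_simps intro!: bcontfun_eqI)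
    then have "norm (x + \<epsilon> *\<^sub>C b x x) = norm (w *\<^sub>C x + complex_of_real (cmod \<epsilon>) *\<^sub>C b (w *\<^sub>C x) (w *\<^sub>C x))"
      using w(1) norm_scaleC[of w "x + \<epsilon> *\<^sub>C b x x"] by simp
    also have "\<dots> \<le> 1 + 13 * (cmod \<epsilon>)\<^sup>2"
      using real[OF wx, of "cmod \<epsilon>"] \<epsilon> by simp
    finally show ?thesis .
  qed
  define x where "x = S f"
  have x: "x \<in> B" using S'(2) f by (simp add: x_def)
  define c where "c = complex_of_real (1 / (norm x + 1))"
  have nc: "cmod c = 1 / (norm x + 1)"
    unfolding c_def norm_of_real by simp
  have pos: "norm x + 1 > 0"
    using norm_ge_zero[of x] by linarith
  have c: "c \<noteq> 0"
    using nc pos by auto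
  have "norm (c *\<^sub>C x) \<le> 1"
    using pos by (simp add: norm_scaleC nc)
  then have "b (c *\<^sub>C x) (c *\<^sub>C x) = 0"
    using x B' by (intro square_eq_0_if_tangent[OF _ bound]) auto
  then have "c *\<^sub>C c *\<^sub>C b x x = 0"
    using x B' by (simp add: scale_left scale_right)
  then have "norm (c *\<^sub>C c *\<^sub>C b x x) = 0" by simp
  then have "b x x = 0"
    using c by (simp add: norm_scaleC)
  then show ?thesis
    using GS[OF f] by (simp add: b_def x_def)
qed

text \<open>Multiplying by the inverse \<open>q\<close> of \<open>S 1\<close> reduces to the unital
  case. As both \<open>S 1\<close> and \<open>q\<close> lie in \<open>B\<close>, the map
  \<open>R\<close> is still onto \<open>B\<close>.\<close>

lemma isometry_square:
  fixes S :: "('k::t2_space \<Rightarrow>\<^sub>C complex) \<Rightarrow> ('q::t2_space \<Rightarrow>\<^sub>C complex)"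
  assumes A: "uniform_algebra A" and B: "uniform_algebra B"
    and S: "S \<in> surj_lin_isometries A B" and f: "f \<in> A"
  shows "S (f * f) s * S 1 s = S f s * S f s"
proof -
  note A' = uniform_algebraD[OF A] and B' = uniform_algebraD[OF B]
  note S' = surj_lin_isometriesD[OF S A]
  note lin = clinear_onD[OF S'(1) A]
  obtain q where q: "q \<in> B" "\<And>s. q s = cnj (S 1 s)" and uq: "S 1 * q = 1"
    using isometry_one_unimodular[OF A B S] by blast
  have uqs: "S 1 s * q s = 1" for s
    using arg_cong[OF uq, of "\<lambda>f. apply_bcontfun f s"] by simp
  have "norm q \<le> 1"
    using norm_bounded[of "S 1"] S'(3)[OF A'(7)] by (intro norm_bound) (simp add: q)
  define R where "R = (\<lambda>f. q * S f)"
  have "norm (q * h) = norm h" for h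
  proof (rule antisym)
    show "norm (q * h) \<le> norm h"
      using norm_mult_ineq[of q h] mult_right_mono[OF \<open>norm q \<le> 1\<close> norm_ge_zero[of h]] by simp
    have "h = S 1 * (q * h)"
      by (simp add: uq flip: mult.assoc)
    then have "norm h \<le> norm (S 1) * norm (q * h)"
      using norm_mult_ineq[of "S 1" "q * h"] by simp
    then show "norm h \<le> norm (q * h)"
      using S'(3)[OF A'(7)] by simp
  qed
  then have "dist (R f) (R g) = dist (S f) (S g)" for f g
    by (simp add: R_def dist_norm flip: right_diff_distrib)
  moreover have "clinear_on A R"
    unfolding clinear_on_def R_def by (auto simp: lin algebra_simps intro!: bcontfun_eqI)
  moreover have "R ` A = B"
  proof
    show "R ` A \<subseteq> B"
      using q S'(2) B' by (auto simp: R_def)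
    show "B \<subseteq> R ` A"
    proof
      fix h assume h: "h \<in> B"
      have "S 1 * h \<in> B"
        using h S'(2) A' B' by simp
      then obtain f where f: "f \<in> A" "S f = S 1 * h"
        using S'(4,5) by metis
      have "R f = h"
        using uqs by (intro bcontfun_eqI) (simp add: R_def f(2) algebra_simps)
      with f show "h \<in> R ` A" by blast
    qed
  qed
  ultimately have R: "R \<in> surj_lin_isometries A B"
    using S by (auto simp: surj_lin_isometries_def)
  have "R 1 = 1"
    using uqs by (intro bcontfun_eqI) (simp add: R_def mult.commute)
  from unital_isometry_square[OF A B R this f]
  have "q s * S (f * f) s = (q s * S f s) * (q s * S f s)"
    by (auto simp: R_def dest: arg_cong[of _ _ "\<lambda>f. apply_bcontfun f s"])
  then have "S 1 s * S 1 s * (q s * S (f * f) s) = S 1 s * S 1 s * ((q s * S f s) * (q s * S f s))"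
    by simp
  then show ?thesis
    using uqs[of s] by algebra
qed

text \<open>Polarisation, used for point evaluations of surjective isometries and of
  \<open>T\<close> alike.\<close>

lemma mult_if_square:
  fixes F :: "('k::t2_space \<Rightarrow>\<^sub>C complex) \<Rightarrow> complex"
  assumes A: "uniform_algebra A"
    and add: "\<And>f g. f \<in> A \<Longrightarrow> g \<in> A \<Longrightarrow> F (f + g) = F f + F g"
    and square: "\<And>f. f \<in> A \<Longrightarrow> F (f * f) * F 1 = F f * F f"
    and f: "f \<in> A" and g: "g \<in> A"
  shows "F (f * g) * F 1 = F f * F g"
proof -
  note A' = uniform_algebraD[OF A]
  have "(f + g) * (f + g) = (f * f + g * g) + (f * g + f * g)"
    by (rule bcontfun_eqI) (simp add: algebra_simps)
  then have "F ((f + g) * (f + g)) = F (f * f) + F (g * g) + 2 * F (f * g)"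
    using f g A' by (simp add: add)
  then have "(F (f * f) + F (g * g) + 2 * F (f * g)) * F 1 = (F f + F g) * (F f + F g)"
    using square[of "f + g"] f g A' by (simp add: add)
  then show ?thesis
    using square[OF f] square[OF g] by (simp add: algebra_simps)
qed

section \<open>Exponentials and the Gleason--Kahane--Zelazko argument\<close>

text \<open>The exponential series converges uniformly and \<open>A\<close> is closed. The
  convergence is exported so that functionals can be applied term by term.\<close>

lemma exp_in_uniform_algebra:
  fixes A :: "('k::t2_space \<Rightarrow>\<^sub>C complex) set"
  assumes A: "uniform_algebra A" and f: "f \<in> A"
  obtains E where "E \<in> A" and "\<And>x. E x = exp (f x)"
    and "(\<lambda>N. \<Sum>n<N. (1 / fact n) *\<^sub>C f ^ n) \<longlonglongrightarrow> E"
proof -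
  note A' = uniform_algebraD[OF A]
  define P where "P = (\<lambda>N. \<Sum>n<N. (1 / fact n) *\<^sub>C f ^ n)"
  have "uniform_limit UNIV (\<lambda>N x. \<Sum>n<N. f x ^ n /\<^sub>R fact n) (\<lambda>x. \<Sum>n. f x ^ n /\<^sub>R fact n) sequentially"
  proof (rule Weierstrass_m_test)
    fix n x
    have "cmod (f x) ^ n \<le> norm f ^ n"
      by (intro power_mono norm_bounded) simp
    then show "cmod (f x ^ n /\<^sub>R fact n) \<le> norm f ^ n /\<^sub>R fact n"
      by (simp add: norm_power divide_simps)
    show "summable (\<lambda>n. norm f ^ n /\<^sub>R fact n)"
      by (rule summable_exp_generic)
  qed
  moreover have "(\<Sum>n<N. f x ^ n /\<^sub>R fact n) = P N x" for N x
    by (simp add: P_def scaleR_conv_of_real divide_inverse)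
  ultimately have "uniform_limit UNIV (\<lambda>N. apply_bcontfun (P N)) (\<lambda>x. exp (f x)) sequentially"
    by (simp add: exp_def)
  then obtain E where E: "(\<lambda>x. exp (f x)) = apply_bcontfun E" "P \<longlonglongrightarrow> E"
    by (rule uniform_limit_bcontfunE) simp
  have "P N \<in> A" for N
    unfolding P_def using f by (intro A')
  then have "E \<in> A"
    using closed_sequentially[OF A'(2)] E(2) by blast
  with E show ?thesis
    by (intro that[of E]) (auto simp: P_def E(1)[symmetric])
qed

text \<open>\<open>E\<close> has the inverse \<open>E' = exp (- f)\<close> in \<open>A\<close>, and
  multiplicativity turns \<open>E * E' = 1\<close> into
  \<open>S E s * S E' s = S 1 s * S 1 s\<close>, which is nonzero.\<close>

lemma isometry_exp_nonzero:
  fixes S :: "('k::t2_space \<Rightarrow>\<^sub>C complex) \<Rightarrow> ('q::t2_space \<Rightarrow>\<^sub>C complex)"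
  assumes A: "uniform_algebra A" and B: "uniform_algebra B"
    and S: "S \<in> surj_lin_isometries A B"
    and f: "f \<in> A" and E: "E \<in> A" "\<And>x. E x = exp (f x)"
  shows "S E s \<noteq> 0"
proof -
  note A' = uniform_algebraD[OF A]
  note lin = clinear_onD[OF surj_lin_isometriesD(1)[OF S A] A]
  obtain E' where E': "E' \<in> A" "\<And>x. E' x = exp (((-1) *\<^sub>C f) x)"
    using exp_in_uniform_algebra[OF A A'(4)[OF f]] by blast
  have EE': "E * E' = 1"
    by (rule bcontfun_eqI) (simp add: E E' flip: exp_add)
  have "S (E * E') s * S 1 s = S E s * S E' s"
    by (rule mult_if_square[OF A, of "\<lambda>g. S g s"])
      (use E E' isometry_square[OF A B S] in \<open>auto simp: lin\<close>)
  moreover have "S 1 s \<noteq> 0"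
  proof -
    obtain q where "S 1 * q = 1"
      using isometry_one_unimodular[OF A B S] by blast
    from arg_cong[OF this, of "\<lambda>f. apply_bcontfun f s"] show ?thesis by auto
  qed
  ultimately show ?thesis
    by (auto simp: EE')
qed

text \<open>The Borel--Caratheodory argument turns the one-sided bound into linear growth of the
  modulus, and Liouville's theorem for polynomial growth finishes.\<close>

lemma entire_affine_if_Re_le:
  assumes hol: "g holomorphic_on UNIV" and Re: "\<And>z. Re (g z) \<le> c * cmod z" and "c \<ge> 0"
  obtains \<beta> where "\<And>z. g z = g 0 + \<beta> * z"
proof -
  define d where "d = cmod (g 0)"
  define g1 where "g1 = (\<lambda>z. g z - g 0)"
  have hol1: "g1 holomorphic_on UNIV"
    unfolding g1_def using hol by (intro holomorphic_intros)
  have Re1: "Re (g1 z) \<le> c * cmod z + d" for z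
    using Re[of z] complex_Re_le_cmod[of "- g 0"] by (simp add: g1_def d_def)
  have bound: "cmod (g1 z) \<le> (4 * c + 2 * d + 2) * cmod z ^ 1" if z: "1 \<le> cmod z" for z
  proof -
    \<comment> \<open>This radius puts \<open>z / r\<close> at modulus \<open>1/2\<close>. The
      summand \<open>1\<close> in \<open>M\<close> makes \<open>M\<close> positive and strictly
      larger than \<open>Re (g1 w)\<close> on the disc of radius \<open>r\<close>.\<close>
    define r where "r = 2 * cmod z"
    define M where "M = c * r + d + 1"
    have "z \<noteq> 0"
      using z by auto
    have M: "M > 0"
      using \<open>c \<ge> 0\<close> by (simp add: M_def r_def d_def add_nonneg_pos)
    \<comment> \<open>The map \<open>\<zeta> / (2 * M - \<zeta>)\<close> takes the half-plane
      \<open>Re \<zeta> < M\<close> into the unit disc and fixes \<open>0\<close>, which prepares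
      the Schwarz lemma.\<close>
    define \<phi> where "\<phi> = (\<lambda>w::complex. g1 (r * w) / (2 * M - g1 (r * w)))"
    have less: "cmod (g1 (r * w)) < cmod (2 * M - g1 (r * w))" if "cmod w < 1" for w :: complex
    proof -
      have "c * (r * cmod w) \<le> c * (r * 1)"
        using that \<open>c \<ge> 0\<close> by (intro mult_left_mono) (auto simp: r_def)
      moreover have "Re (g1 (r * w)) \<le> c * (r * cmod w) + d"
        using Re1[of "r * w"] by (simp add: norm_mult r_def)
      ultimately have "Re (g1 (r * w)) < M"
        unfolding M_def by linarith
      then have "0 < 4 * M * (M - Re (g1 (r * w)))"
        using M by simp
      also have "\<dots> = (cmod (2 * M - g1 (r * w)))\<^sup>2 - (cmod (g1 (r * w)))\<^sup>2"
        unfolding cmod_power2 by (simp add: power2_eq_square algebra_simps)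
      finally have "(cmod (g1 (r * w)))\<^sup>2 < (cmod (2 * M - g1 (r * w)))\<^sup>2"
        by linarith
      then show ?thesis
        by (rule power2_less_imp_less) simp
    qed
    have "cmod (\<phi> (z / r)) \<le> cmod (z / r)"
    proof (rule Schwarz_Lemma(1))
      have "g1 \<circ> (\<lambda>w. r * w) holomorphic_on ball 0 1"
        by (intro holomorphic_on_compose_gen[OF _ hol1]) (auto intro!: holomorphic_intros)
      moreover have "2 * M - g1 (r * w) \<noteq> 0" if "w \<in> ball 0 1" for w :: complex
        using less[of w] that by auto
      ultimately show "\<phi> holomorphic_on ball 0 1"
        unfolding \<phi>_def by (auto intro!: holomorphic_intros simp: o_def)
      show "\<phi> 0 = 0"
        by (simp add: \<phi>_def g1_def)
      show "cmod (\<phi> w) < 1" if "cmod w < 1" for w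
        using less[OF that] le_less_trans[OF norm_ge_zero less[OF that]]
        by (simp add: \<phi>_def norm_divide)
      show "cmod (z / r) < 1"
        using z by (simp add: r_def norm_divide)
    qed
    also have "cmod (z / r) = 1/2"
      using \<open>z \<noteq> 0\<close> by (simp add: r_def norm_divide)
    also have "\<phi> (z / r) = g1 z / (2 * M - g1 z)"
      using \<open>z \<noteq> 0\<close> by (simp add: \<phi>_def r_def)
    finally have "cmod (g1 z) \<le> 1/2 * cmod (2 * M - g1 z)"
      using less[of "z / r"] \<open>z \<noteq> 0\<close> by (simp add: norm_divide r_def divide_simps split: if_splits)
    also have "\<dots> \<le> 1/2 * (2 * M + cmod (g1 z))"
      using norm_triangle_ineq4[of "2 * of_real M" "g1 z"] M by (simp add: norm_mult)
    finally have "cmod (g1 z) \<le> 2 * M"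
      by simp
    also have "\<dots> = 4 * c * cmod z + (2 * d + 2) * 1"
      by (simp add: M_def r_def)
    also have "\<dots> \<le> 4 * c * cmod z + (2 * d + 2) * cmod z"
      using z by (intro add_left_mono mult_left_mono) (auto simp: d_def)
    finally show ?thesis
      by (simp add: algebra_simps)
  qed
  have "g1 z = (\<Sum>k\<le>1. (deriv ^^ k) g1 0 / fact k * z ^ k)" for z
    using hol1 bound by (rule Liouville_polynomial)
  also have "(\<Sum>k\<le>1. (deriv ^^ k) g1 0 / fact k * z ^ k) = g1 0 + deriv g1 0 * z" for z
    by simp
  finally have "g1 z = g1 0 + deriv g1 0 * z" for z .
  moreover have "g1 0 = 0" and "g z = g 0 + g1 z" for z
    by (simp_all add: g1_def)
  ultimately have "g z = g 0 + deriv g1 0 * z" for z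
    by (metis add_0)
  then show ?thesis
    by (rule that)
qed

text \<open>Comparing the Taylor coefficients of \<open>F (exp (z * f))\<close> with those of
  \<open>F 1 * exp (\<beta> * z)\<close> gives \<open>F (f ^ n) = F 1 * \<beta> ^ n\<close>; the
  cases \<open>n = 1\<close> and \<open>n = 2\<close> yield the claim.\<close>

lemma exp_nonvanishing_functional_square:
  fixes F :: "('k::t2_space \<Rightarrow>\<^sub>C complex) \<Rightarrow> complex"
  assumes A: "uniform_algebra A"
    and add: "\<And>f g. f \<in> A \<Longrightarrow> g \<in> A \<Longrightarrow> F (f + g) = F f + F g"
    and scale: "\<And>c f. f \<in> A \<Longrightarrow> F (c *\<^sub>C f) = c * F f"
    and bound: "\<And>f. f \<in> A \<Longrightarrow> cmod (F f) \<le> norm f"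
    and nonzero: "\<And>f E. f \<in> A \<Longrightarrow> E \<in> A \<Longrightarrow> (\<And>x. E x = exp (f x)) \<Longrightarrow> F E \<noteq> 0"
    and f: "f \<in> A"
  shows "F (f * f) * F 1 = F f * F f"
proof -
  note A' = uniform_algebraD[OF A]
  have diff: "F (f - g) = F f - F g" if "f \<in> A" "g \<in> A" for f g
    using add[of "f - g" g] that A' by simp
  have zero: "F 0 = 0"
    using diff[OF A'(7) A'(7)] by simp
  have sum: "F (\<Sum>n<N. g n) = (\<Sum>n<N. F (g n))" if "\<And>n. g n \<in> A" for g and N :: nat
    by (induction N) (auto simp: zero add that A')
  have "\<exists>E. \<forall>z. E z \<in> A \<and> (\<forall>x. E z x = exp ((z *\<^sub>C f) x)) \<and>
      (\<lambda>N. \<Sum>n<N. (1 / fact n) *\<^sub>C (z *\<^sub>C f) ^ n) \<longlonglongrightarrow> E z"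
    using exp_in_uniform_algebra[OF A A'(4)[OF f]] by (intro choice allI) metis
  then obtain E where E: "\<And>z. E z \<in> A" "\<And>z x. E z x = exp ((z *\<^sub>C f) x)"
    "\<And>z. (\<lambda>N. \<Sum>n<N. (1 / fact n) *\<^sub>C (z *\<^sub>C f) ^ n) \<longlonglongrightarrow> E z"
    by blast
  define h where "h = (\<lambda>z. F (E z))"
  \<comment> \<open>\<open>F\<close> is continuous by \<open>bound\<close>, so it passes through the
    exponential series.\<close>
  have h_sums: "(\<lambda>n. F (f ^ n) / fact n * z ^ n) sums h z" for z
  proof -
    define P where "P = (\<lambda>N. \<Sum>n<N. (1 / fact n) *\<^sub>C (z *\<^sub>C f) ^ n)"
    have P: "P N \<in> A" for N
      unfolding P_def using f by (intro A')
    have "(\<lambda>N. F (P N) - F (E z)) \<longlonglongrightarrow> 0"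
    proof (rule Lim_null_comparison)
      show "\<forall>\<^sub>F N in sequentially. norm (F (P N) - F (E z)) \<le> norm (P N - E z)"
        using P E bound A' by (simp flip: diff)
      show "(\<lambda>N. norm (P N - E z)) \<longlonglongrightarrow> 0"
        using E(3)[of z] by (simp add: P_def tendsto_norm_zero LIM_zero)
    qed
    then have "(\<lambda>N. F (P N)) \<longlonglongrightarrow> h z"
      unfolding h_def by (rule LIM_zero_cancel)
    moreover have "F (P N) = (\<Sum>n<N. F (f ^ n) / fact n * z ^ n)" for N
    proof -
      have "(z *\<^sub>C f) ^ n = z ^ n *\<^sub>C f ^ n" for n
        by (rule bcontfun_eqI) (simp add: power_mult_distrib)
      then show ?thesis
        unfolding P_def using f A' by (simp add: sum scale mult.commute)
    qed
    ultimately show ?thesis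
      by (simp add: sums_def)
  qed
  have "h holomorphic_on ball 0 r" for r
    by (rule power_series_holomorphic[where a = "\<lambda>n. F (f ^ n) / fact n"]) (use h_sums in simp)
  then have "h field_differentiable at z" for z
    using holomorphic_on_imp_differentiable_at[of h "ball 0 (cmod z + 1)" z] by simp
  then have hol: "h holomorphic_on UNIV"
    by (simp add: holomorphic_on_def)
  have "h z \<noteq> 0" for z
    unfolding h_def using nonzero[OF A'(4)[OF f] E(1,2)] .
  then obtain g where g: "g holomorphic_on UNIV" "\<And>z. exp (g z) = h z"
    using holomorphic_logarithm_exists[of UNIV h 0] hol by auto
  have "Re (g z) \<le> norm f * cmod z" for z
  proof -
    have "norm (E z) \<le> exp (norm f * cmod z)"
    proof (rule norm_bound)
      fix x
      have "Re (z * f x) \<le> cmod z * norm f"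
        using complex_Re_le_cmod[of "z * f x"] mult_left_mono[OF norm_bounded[of f x], of "cmod z"]
        by (simp add: norm_mult)
      then show "cmod (E z x) \<le> exp (norm f * cmod z)"
        by (simp add: E(2) norm_exp_eq_Re mult.commute)
    qed
    then have "exp (Re (g z)) \<le> exp (norm f * cmod z)"
      using bound[OF E(1)[of z]] by (simp add: g(2) h_def flip: norm_exp_eq_Re)
    then show ?thesis
      by simp
  qed
  then obtain \<beta> where \<beta>: "\<And>z. g z = g 0 + \<beta> * z"
    using entire_affine_if_Re_le[OF g(1)] norm_ge_zero by metis
  define a where "a = (\<lambda>n. (F (f ^ n) - h 0 * \<beta> ^ n) / fact n)"
  have a_sums: "(\<lambda>n. a n * z ^ n) sums 0" for z
  proof -
    have "(\<lambda>n. (\<beta> * z) ^ n /\<^sub>R fact n) sums exp (\<beta> * z)"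
      by (rule exp_converges)
    then have "(\<lambda>n. h 0 * ((\<beta> * z) ^ n /\<^sub>R fact n)) sums (h 0 * exp (\<beta> * z))"
      by (rule sums_mult)
    moreover have "h z = h 0 * exp (\<beta> * z)"
      using \<beta>[of z] by (metis g(2) exp_add)
    ultimately have "(\<lambda>n. F (f ^ n) / fact n * z ^ n - h 0 * ((\<beta> * z) ^ n /\<^sub>R fact n)) sums 0"
      using sums_diff[OF h_sums[of z]] by fastforce
    moreover have "F (f ^ n) / fact n * z ^ n - h 0 * ((\<beta> * z) ^ n /\<^sub>R fact n) = a n * z ^ n" for n
      by (simp add: a_def scaleR_conv_of_real power_mult_distrib field_simps)
    ultimately show ?thesis by simp
  qed
  have a_0: "a n = 0" if n: "n > 0" for n
  proof (rule ccontr)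
    assume "a n \<noteq> 0"
    \<comment> \<open>A power series with a nonzero coefficient of positive index would be nonzero
      on a punctured disc, but the sum here is \<open>0\<close>. Index \<open>0\<close> is settled
      separately by evaluating at \<open>z = 0\<close>.\<close>
    obtain r where "0 < r" "\<And>z::complex. z \<in> cball 0 r - {0} \<Longrightarrow> (0::complex) \<noteq> 0"
      by (rule powser_0_nonzero[of 1 0 a "\<lambda>_. 0" n]) (use a_sums n \<open>a n \<noteq> 0\<close> in auto)
    from this(2)[of "of_real r"] this(1) show False by simp
  qed
  have "h 0 = F 1"
    using sums_unique2[OF h_sums[of 0] powser_sums_zero] by simp
  moreover have "F f = h 0 * \<beta>"
    using a_0[of 1] by (simp add: a_def)
  moreover have "F (f * f) = h 0 * \<beta>\<^sup>2"
    using a_0[of 2] by (simp add: a_def power2_eq_square)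
  ultimately show ?thesis
    by (simp add: power2_eq_square)
qed

section \<open>Stone--Weierstrass on a quotient space\<close>

text \<open>
  The library has no \<open>t2_space\<close> instance for the product topology on functions (it would clash with
  the metric instance for countable index types), hence this copy of the function type.
\<close>

typedef 'a coords = "UNIV :: ('a \<Rightarrow> complex) set" ..

instantiation coords :: (type) t2_space
begin

definition open_coords :: "'a coords set \<Rightarrow> bool" where
  "open_coords U \<longleftrightarrow> open (Abs_coords -` U)"

instance
proof
  show "open (UNIV :: 'a coords set)"
    by (simp add: open_coords_def)
  show "open (U \<inter> V)" if "open U" "open V" for U V :: "'a coords set"
    using that by (simp add: open_coords_def open_Int)
  show "open (\<Union>K)" if "\<forall>U\<in>K. open U" for K :: "'a coords set set"
    using that by (simp add: open_coords_def vimage_Union open_UN)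
  show "\<exists>U V. open U \<and> open V \<and> f \<in> U \<and> g \<in> V \<and> U \<inter> V = {}" if "f \<noteq> g" for f g :: "'a coords"
  proof -
    obtain i where "Rep_coords f i \<noteq> Rep_coords g i"
      using \<open>f \<noteq> g\<close> by (metis Rep_coords_inject ext)
    then obtain U V where UV: "open U" "open V" "Rep_coords f i \<in> U" "Rep_coords g i \<in> V" "U \<inter> V = {}"
      using hausdorff by metis
    define pre where "pre = (\<lambda>W. (\<lambda>h. Rep_coords h i) -` W)"
    have "open (pre W)" if "open W" for W
    proof -
      have "Abs_coords -` pre W = (\<lambda>h. h i) -` W"
        by (auto simp: pre_def Abs_coords_inverse)
      then show ?thesis
        using that by (simp add: open_coords_def open_vimage continuous_on_product_coordinates)
    qed
    with UV show ?thesis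
      by (intro exI[of _ "pre U"] exI[of _ "pre V"]) (auto simp: pre_def)
  qed
qed

end

lemma continuous_on_Abs_coords: "continuous_on S Abs_coords"
  by (rule continuous_on_subset[of UNIV])
    (auto simp: continuous_on_open_vimage open_coords_def)

lemma continuous_on_Rep_coords: "continuous_on S (\<lambda>y. Rep_coords y i)"
proof (rule continuous_on_subset[of UNIV])
  have "Abs_coords -` (\<lambda>y. Rep_coords y i) -` W = (\<lambda>h. h i) -` W" for W
    by (auto simp: Abs_coords_inverse)
  then show "continuous_on UNIV (\<lambda>y. Rep_coords y i)"
    by (simp add: continuous_on_open_vimage open_coords_def open_vimage continuous_on_product_coordinates)
qed simp

text \<open>
  Stone--Weierstrass for the self-adjoint part of \<open>B\<close>, which need not separate the points of the
  space; the theorem is applied to the quotient by the fibres, realised inside a product space.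
\<close>

lemma real_function_in_uniform_algebra:
  fixes B :: "('q::t2_space \<Rightarrow>\<^sub>C complex) set" and v :: "'q \<Rightarrow> real"
  assumes B: "uniform_algebra B" and cont: "continuous_on UNIV v"
    and fibre: "\<And>s t. (\<And>c d. c \<in> B \<Longrightarrow> d \<in> B \<Longrightarrow> (\<And>x. d x = cnj (c x)) \<Longrightarrow> c s = c t) \<Longrightarrow> v s = v t"
  shows "\<exists>c\<in>B. \<forall>s. c s = of_real (v s)"
proof -
  note B' = uniform_algebraD[OF B]
  define C where "C = {c\<in>B. \<exists>d\<in>B. \<forall>x. d x = cnj (c x)}"
  \<comment> \<open>A point is sent to the family of its values under the self-adjoint part
    \<open>C\<close>, so the fibres of \<Phi> are the classes not separated by \<open>C\<close>.
    Coordinates outside \<open>C\<close> get the dummy value \<open>0\<close>.\<close>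
  define \<Phi> where "\<Phi> = (\<lambda>s. Abs_coords (\<lambda>c. if c \<in> C then apply_bcontfun c s else 0))"
  have \<Phi>: "Rep_coords (\<Phi> s) c = (if c \<in> C then c s else 0)" for s c
    by (simp add: \<Phi>_def Abs_coords_inverse)
  define X where "X = range \<Phi>"
  have \<Phi>_cont: "continuous_on Y \<Phi>" for Y
    unfolding \<Phi>_def
  proof (intro continuous_on_compose2[OF continuous_on_Abs_coords] continuous_on_coordinatewise_then_product)
    fix c
    show "continuous_on Y (\<lambda>s. if c \<in> C then apply_bcontfun c s else 0)"
      by (cases "c \<in> C") auto
  qed (rule subset_refl)
  have X: "compact X"
    unfolding X_def using \<Phi>_cont B'(1) by (rule compact_continuous_image)
  \<comment> \<open>This is \<open>v\<close> on the quotient; by \<open>fibre\<close> the choice of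
    preimage does not matter.\<close>
  define w where "w = (\<lambda>y. v (SOME s. \<Phi> s = y))"
  have w: "w (\<Phi> s) = v s" for s
  proof -
    define t where "t = (SOME t. \<Phi> t = \<Phi> s)"
    have "\<Phi> t = \<Phi> s"
      unfolding t_def by (rule someI) simp
    then have "c t = c s" if "c \<in> C" for c
      using that \<Phi>[of t c] \<Phi>[of s c] by simp
    then have "v t = v s"
      by (intro fibre) (auto simp: C_def)
    then show ?thesis by (simp add: w_def t_def)
  qed
  \<comment> \<open>By compactness \<Phi> maps closed sets to closed sets, and preimages under
    \<open>w\<close> are images under \<Phi> of preimages under \<open>v\<close>.\<close>
  have w_cont: "continuous_on X w"
    unfolding continuous_on_closed_vimage[OF compact_imp_closed[OF X]]
  proof (intro allI impI)
    fix Z :: "real set" assume "closed Z"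
    then have "closed (v -` Z)"
      using cont by (simp add: closed_vimage)
    then have "compact (v -` Z)"
      using B'(1) compact_Int_closed by fastforce
    then have "closed (\<Phi> ` (v -` Z))"
      by (intro compact_imp_closed compact_continuous_image \<Phi>_cont)
    moreover have "w -` Z \<inter> X = \<Phi> ` (v -` Z)"
      by (auto simp: X_def w)
    ultimately show "closed (w -` Z \<inter> X)" by simp
  qed
  define R where "R = {g. continuous_on X g \<and> (\<exists>c\<in>B. \<forall>s. c s = complex_of_real (g (\<Phi> s)))}"
  interpret function_ring_on R X
  proof
    show "compact X" by (rule X)
    show "continuous_on X f" if "f \<in> R" for f
      using that by (simp add: R_def)
    show "(\<lambda>x. f x + g x) \<in> R" if f: "f \<in> R" and g: "g \<in> R" for f g
    proof -
      obtain c d where "c \<in> B" "\<forall>s. c s = complex_of_real (f (\<Phi> s))"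
        "d \<in> B" "\<forall>s. d s = complex_of_real (g (\<Phi> s))"
        using f g by (auto simp: R_def)
      then show ?thesis
        using f g B' by (auto simp: R_def intro!: continuous_intros bexI[of _ "c + d"])
    qed
    show "(\<lambda>x. f x * g x) \<in> R" if f: "f \<in> R" and g: "g \<in> R" for f g
    proof -
      obtain c d where "c \<in> B" "\<forall>s. c s = complex_of_real (f (\<Phi> s))"
        "d \<in> B" "\<forall>s. d s = complex_of_real (g (\<Phi> s))"
        using f g by (auto simp: R_def)
      then show ?thesis
        using f g B' by (auto simp: R_def intro!: continuous_intros bexI[of _ "c * d"])
    qed
    show "(\<lambda>_. r) \<in> R" for r
      using B'(6)[of "of_real r"] by (auto simp: R_def intro!: bexI[of _ "const_bcontfun (of_real r)"])
    show "\<exists>f\<in>R. f x \<noteq> f y" if "x \<in> X" "y \<in> X" "x \<noteq> y" for x y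
    proof -
      obtain s t where st: "x = \<Phi> s" "y = \<Phi> t"
        using \<open>x \<in> X\<close> \<open>y \<in> X\<close> unfolding X_def by blast
      then obtain c where "Rep_coords x c \<noteq> Rep_coords y c"
        using \<open>x \<noteq> y\<close> by (metis Rep_coords_inject ext)
      with st have c: "Rep_coords x c \<noteq> Rep_coords y c" "c \<in> C"
        by (auto simp: \<Phi> split: if_splits)
      from c(2) obtain d where d: "c \<in> B" "d \<in> B" "\<And>x. d x = cnj (c x)"
        by (auto simp: C_def)
      \<comment> \<open>Stone--Weierstrass needs real functions, so the separating coordinate is
        split. As \<open>d\<close> is the conjugate of \<open>c\<close>, the two parts pull back to
        combinations of \<open>c\<close> and \<open>d\<close>, hence into \<open>B\<close>.\<close>
      have "(\<lambda>y. Re (Rep_coords y c)) \<in> R"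
        unfolding R_def using c d B' continuous_on_Rep_coords
        by (auto simp: \<Phi> complex_eq_iff intro!: continuous_intros bexI[of _ "(1/2) *\<^sub>C (c + d)"])
      moreover have "(\<lambda>y. Im (Rep_coords y c)) \<in> R"
        unfolding R_def using c d B' continuous_on_Rep_coords
        by (auto simp: \<Phi> complex_eq_iff intro!: continuous_intros bexI[of _ "(- \<i> / 2) *\<^sub>C (c - d)"])
      moreover have "Re (Rep_coords x c) \<noteq> Re (Rep_coords y c) \<or> Im (Rep_coords x c) \<noteq> Im (Rep_coords y c)"
        using c(1) by (simp add: complex_eq_iff)
      ultimately show ?thesis
        by (elim disjE) (rule bexI, assumption, assumption)+
    qed
  qed
  have "compact (range v)"
    using cont B'(1) by (rule compact_continuous_image)
  then have "bounded (range v)"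
    by (rule compact_imp_bounded)
  then obtain M where "\<And>s. \<bar>v s\<bar> \<le> M"
    by (auto simp: bounded_iff)
  then have "(\<lambda>s. complex_of_real (v s)) \<in> bcontfun"
    using cont by (intro bcontfun_normI[of _ M]) (auto intro!: continuous_intros)
  then obtain vb where vb: "(\<lambda>s. complex_of_real (v s)) = apply_bcontfun vb"
    by (rule bcontfunE)
  have "\<exists>c\<in>B. dist c vb < e" if e: "e > 0" for e
  proof -
    obtain g where g: "g \<in> R" "\<forall>x\<in>X. \<bar>w x - g x\<bar> < e / 2"
      using Stone_Weierstrass_basic[OF w_cont, of "e / 2"] e by auto
    then obtain c where c: "c \<in> B" "\<And>s. c s = complex_of_real (g (\<Phi> s))"
      by (auto simp: R_def)
    have "dist c vb \<le> e / 2"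
    proof (rule dist_bound)
      fix s
      have "\<bar>w (\<Phi> s) - g (\<Phi> s)\<bar> < e / 2"
        using g(2) by (auto simp: X_def)
      then have "\<bar>g (\<Phi> s) - v s\<bar> \<le> e / 2"
        unfolding w by linarith
      then show "dist (c s) (vb s) \<le> e / 2"
        unfolding c(2) vb[symmetric] dist_of_real by (simp add: dist_real_def)
    qed
    then show ?thesis
      using c(1) e by (intro bexI[of _ c]) auto
  qed
  then have "vb \<in> B"
    using closed_approachable[OF B'(2), of vb] by blast
  then show ?thesis
    using vb by (intro bexI[of _ vb]) (auto simp: vb[symmetric])
qed

theorem theorem2p3:
  fixes A :: "('k::t2_space \<Rightarrow>\<^sub>C complex) set"
    and B :: "('q::t2_space \<Rightarrow>\<^sub>C complex) set"
    and T :: "('k \<Rightarrow>\<^sub>C complex) \<Rightarrow> ('q \<Rightarrow>\<^sub>C complex)"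
  assumes "uniform_algebra A" and "uniform_algebra B"
    and "weak_local_isometry A B T"
  shows "\<exists>u \<psi>. u \<in> B \<and> unimodular u \<and> unital_algebra_hom A B \<psi> \<and> (\<forall>f\<in>A. T f = u * \<psi> f)"
proof -
  note A = assms(1) and B = assms(2)
  note A' = uniform_algebraD[OF A] and B' = uniform_algebraD[OF B]
  have T: "clinear_on A T" "\<And>f. f \<in> A \<Longrightarrow> T f \<in> B"
    and local: "\<And>f \<phi>. f \<in> A \<Longrightarrow> \<phi> \<in> dual B \<Longrightarrow> \<exists>S\<in>surj_lin_isometries A B. \<phi> (T f) = \<phi> (S f)"
    using assms(3) by (auto simp: weak_local_isometry_def)
  note lin = clinear_onD[OF T(1) A]
  \<comment> \<open>The weak-local property is applied to the evaluation at \<open>s\<close>; the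
    isometry depends on both \<open>f\<close> and \<open>s\<close>.\<close>
  have local_at: "\<exists>S\<in>surj_lin_isometries A B. T f s = S f s" if "f \<in> A" for f s
  proof -
    have "(\<lambda>g. apply_bcontfun g s) \<in> dual B"
      using norm_bounded[of _ s] by (auto simp: dual_def intro!: exI[of _ 1])
    from local[OF that this] show ?thesis .
  qed
  define u where "u = T 1"
  have u: "u \<in> B"
    using T(2) A' by (simp add: u_def)
  have unimod: "cmod (u s) = 1" for s
  proof -
    obtain S where S: "S \<in> surj_lin_isometries A B" "u s = S 1 s"
      using local_at[OF A'(7)] by (auto simp: u_def)
    obtain q where q: "apply_bcontfun q s = cnj (S 1 s)" "S 1 * q = 1"
      using isometry_one_unimodular[OF A B S(1)] by metis
    have "S 1 s * cnj (S 1 s) = 1"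
      using arg_cong[OF q(2), of "\<lambda>f. apply_bcontfun f s"] by (simp add: q(1))
    then have "complex_of_real ((cmod (u s))\<^sup>2) = 1"
      unfolding S(2) complex_norm_square .
    then have "(cmod (u s))\<^sup>2 = 1\<^sup>2"
      by (simp only: of_real_eq_1_iff one_power2)
    then show ?thesis
      by (rule power2_eq_imp_eq) auto
  qed
  \<comment> \<open>For the difference of two evaluations, one \<open>S\<close> serves both points.
    \<open>S 1\<close> and its conjugate lie in \<open>B\<close>, so \<open>st\<close> gives
    \<open>S 1\<close> equal values at \<open>s\<close> and \<open>t\<close>, and \<open>u\<close>
    inherits this.\<close>
  have fibre: "u s = u t"
    if st: "\<And>c d. c \<in> B \<Longrightarrow> d \<in> B \<Longrightarrow> (\<And>x. d x = cnj (c x)) \<Longrightarrow> c s = c t" for s t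
  proof -
    have "cmod (g s - g t) \<le> 2 * norm g" for g :: "'q \<Rightarrow>\<^sub>C complex"
      using norm_triangle_ineq4[of "g s" "g t"] norm_bounded[of g s] norm_bounded[of g t] by linarith
    then have "(\<lambda>g. apply_bcontfun g s - apply_bcontfun g t) \<in> dual B"
      by (auto simp: dual_def algebra_simps intro!: exI[of _ 2])
    from local[OF A'(7) this] obtain S where S: "S \<in> surj_lin_isometries A B"
      and eq: "u s - u t = S 1 s - S 1 t"
      by (auto simp: u_def)
    obtain q where "q \<in> B" "\<And>s. q s = cnj (S 1 s)"
      using isometry_one_unimodular[OF A B S] by metis
    then have "S 1 s = S 1 t"
      using surj_lin_isometriesD(2)[OF S A A'(7)] by (intro st)
    with eq show ?thesis by simp
  qed
  have part: "\<exists>a\<in>B. \<forall>s. a s = complex_of_real (p (u s))" if p: "continuous_on UNIV p" for p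
  proof (rule real_function_in_uniform_algebra[OF B])
    show "continuous_on UNIV (\<lambda>s. p (u s))"
      by (rule continuous_on_compose2[OF p]) auto
    show "p (u s) = p (u t)"
      if st: "\<And>c d. c \<in> B \<Longrightarrow> d \<in> B \<Longrightarrow> (\<And>x. d x = cnj (c x)) \<Longrightarrow> c s = c t" for s t
      by (rule arg_cong[OF fibre]) (rule st)
  qed
  \<comment> \<open>The real and imaginary parts of \<open>u\<close> lie in \<open>B\<close>, hence
    so does the conjugate \<open>v\<close>, which inverts \<open>u\<close>.\<close>
  obtain a where a: "a \<in> B" "\<And>s. a s = of_real (Re (u s))"
    using part[OF continuous_on_Re[OF continuous_on_id]] by auto
  obtain b where b: "b \<in> B" "\<And>s. b s = of_real (Im (u s))"
    using part[OF continuous_on_Im[OF continuous_on_id]] by auto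
  define v where "v = a - \<i> *\<^sub>C b"
  have v: "v \<in> B"
    unfolding v_def using a b by (intro B')
  have "v s = cnj (u s)" for s
    by (simp add: v_def a b complex_eq_iff)
  then have uv: "u s * v s = 1" for s
    using complex_norm_square[of "u s"] unimod[of s] by simp
  \<comment> \<open>The norm bound and the nonvanishing on exponentials concern one function at a
    time, so each is read off from the isometry belonging to that function.\<close>
  have T_mult: "T (f * g) s * T 1 s = T f s * T g s" if f: "f \<in> A" and g: "g \<in> A" for f g s
  proof (rule mult_if_square[OF A _ _ f g])
    show "T (f + g) s = T f s + T g s" if "f \<in> A" "g \<in> A" for f g
      using that by (simp add: lin)
    show "T (f * f) s * T 1 s = T f s * T f s" if f: "f \<in> A" for f
    proof (rule exp_nonvanishing_functional_square[OF A _ _ _ _ f])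
      show "T (f + g) s = T f s + T g s" if "f \<in> A" "g \<in> A" for f g
        using that by (simp add: lin)
      show "T (c *\<^sub>C f) s = c * T f s" if "f \<in> A" for c f
        using that by (simp add: lin)
      show "cmod (T f s) \<le> norm f" if f: "f \<in> A" for f
      proof -
        obtain S where "S \<in> surj_lin_isometries A B" "T f s = S f s"
          using local_at[OF f] by blast
        then show ?thesis
          using norm_bounded[of "S f" s] surj_lin_isometriesD(3)[of S A B, OF _ A f] by simp
      qed
      show "T E s \<noteq> 0" if fE: "f \<in> A" "E \<in> A" "\<And>x. E x = exp (f x)" for f E
      proof -
        obtain S where "S \<in> surj_lin_isometries A B" "T E s = S E s"
          using local_at[OF fE(2)] by blast
        with isometry_exp_nonzero[OF A B _ fE] show ?thesis by simp
      qed
    qed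
  qed
  \<comment> \<open>As \<open>v\<close> inverts \<open>u = T 1\<close>, this is \<open>T\<close>
    divided by \<open>T 1\<close>, and \<open>T_mult\<close> becomes multiplicativity.\<close>
  define \<psi> where "\<psi> = (\<lambda>f. v * T f)"
  have "clinear_on A \<psi>"
    unfolding clinear_on_def \<psi>_def by (auto simp: lin algebra_simps intro!: bcontfun_eqI)
  moreover have "\<psi> ` A \<subseteq> B"
    using v T(2) B' by (auto simp: \<psi>_def)
  moreover have "\<psi> (f * g) = \<psi> f * \<psi> g" if "f \<in> A" "g \<in> A" for f g
  proof (rule bcontfun_eqI)
    fix s
    show "\<psi> (f * g) s = (\<psi> f * \<psi> g) s"
      using T_mult[OF that, of s] uv[of s] unfolding \<psi>_def u_def times_bcontfun.rep_eq by algebra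
  qed
  moreover have "\<psi> 1 = 1"
    using uv by (intro bcontfun_eqI) (simp add: \<psi>_def u_def mult.commute)
  moreover have "T f = u * \<psi> f" for f
    by (rule bcontfun_eqI) (simp add: \<psi>_def uv flip: mult.assoc)
  ultimately show ?thesis
    using u unimod by (intro exI[of _ u] exI[of _ \<psi>]) (auto simp: unimodular_def unital_algebra_hom_def)
qed

end
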